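(* Let $\mathcal A\subseteq\mathcal Q=\{1,\dots,q\}$ be an active set that exists for the QP described in the context (i.e. there is $x\in\mathcal X_f$ with $\mathcal A(x)=\mathcal A$), where the constraints are ordered as in the context, and assume that $G_{\mathcal A}$ has full row rank. Let $G^{11}$ be the block consisting of the first $q_{\mathcal U}+q_{\mathcal X}$ rows and first $m$ columns of $G$, and assume that $G^{11}_{\tilde{\mathcal A}}$ is invertible, where $\tilde{\mathcal A}=\mathcal A\cap\{1,\dots,q_{\mathcal U}+q_{\mathcal X}\}$. Let $$\mathcal E(\mathcal A)=\{\mathcal A'\subseteq\mathcal Q\mid\mathcal A\cap\{1,\dots,q_{\mathcal U}+q_{\mathcal X}\}\subseteq\mathcal A'\subseteq\mathcal A\}.$$ Then, for any $\mathcal A'\in\mathcal E(\mathcal A)$ with $|\mathcal A'\cap\{1,\dots,q_{\mathcal U}+q_{\mathcal X}\}|=m$, the feedback law $K^\star x+b^\star$ with $$K^\star=(G^{11}_{\tilde{\mathcal A}'})^{-1}E_{\tilde{\mathcal A}'},\qquad b^\star=(G^{11}_{\tilde{\mathcal A}'})^{-1}w_{\tilde{\mathcal A}'},\qquad\tilde{\mathcal A}'=\mathcal A'\cap\{1,\dots,q_{\mathcal U}+q_{\mathcal X}\},$$ yields the optimal input $u^\star(0)$ for all $x\in\Pi(\mathcal A')$; that is, for every $x\in\Pi(\mathcal A')$ the first $m$ components of the optimal solution $\bar U^\star(x)$ of the QP equal $K^\star x+b^\star$.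
   Context: Optimal control problem. Let $N\ge 2$ be the horizon, $A\in\mathbb R^{n\times n}$, $B\in\mathbb R^{n\times m}$. For a given initial state $x(0)\in\mathbb R^n$ (also written $x$) minimize $\|x(N)\|_P^2+\sum_{k=0}^{N-1}(\|x(k)\|_Q^2+\|u(k)\|_R^2)$ (with $\|v\|_M^2=v'Mv$, and $'$ on vectors and matrices denoting transpose) over $u(0),\dots,u(N-1)\in\mathbb R^m$ and $x(1),\dots,x(N)\in\mathbb R^n$, subject to $x(k+1)=Ax(k)+Bu(k)$, $x(k)\in\mathcal X$, $u(k)\in\mathcal U$ for $k=0,\dots,N-1$, and $x(N)\in\mathcal T$. Standing assumptions: $(A,B)$ stabilizable, $(Q^{1/2},A)$ detectable, $Q\succeq0$, $R\succ0$; $\mathcal X\subset\mathbb R^n$, $\mathcal U\subset\mathbb R^m$ and $\mathcal T\subseteq\mathcal X$ are compact polytopes (a polytope is an intersection of finitely many halfspaces) containing the origin as an interior point. $P\succ0$ is the solution of the discrete-time algebraic Riccati equation, and $\mathcal T$ is the closure of the largest open set on which the associated linear quadratic regulator stabilizes the system without activating the constraints. $\mathcal U,\mathcal X,\mathcal T$ are given by $q_{\mathcal U},q_{\mathcal X},q_{\mathcal T}$ halfspaces (linear inequalities), respectively. QP. Eliminating $x(1),\dots,x(N)$ by $x(k)=A^kx(0)+\sum_{j=0}^{k-1}A^{k-1-j}Bu(j)$ in the cost and in the inequalities turns the problem into the equivalent QP $\min_{\bar U}\frac12\bar U'H\bar U+x'F\bar U+\frac12x'Yx$ subject to $G\bar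 U\le w+Ex$, with $\bar U=(u(0)',\dots,u(N-1)')'\in\mathbb R^{mN}$, $H\succ0$, $G\in\mathbb R^{q\times mN}$, $w\in\mathbb R^q$, $E\in\mathbb R^{q\times n}$, where $q$ is the total number of inequalities. Order of constraints: the rows of $G,w,E$ correspond to the inequalities in the order $u(0)\in\mathcal U$, $x(1)\in\mathcal X$; $u(1)\in\mathcal U$, $x(2)\in\mathcal X$; $\dots$; $u(N-1)\in\mathcal U$, $x(N)\in\mathcal T$; and finally $x(0)\in\mathcal X$. Consequently the first $q_{\mathcal U}+q_{\mathcal X}$ rows of $G$ have the form $(G^{11}\ \ 0)$ with $G^{11}$ having $m$ columns. Active sets. $\mathcal X_f$ is the set of $x$ for which the QP has a solution; for $x\in\mathcal X_f$ the solution $\bar U^\star(x)$ is unique. $\mathcal A(x)=\{i\in\mathcal Q\mid G_i\bar U^\star(x)=w_i+E_ix\}$. A matrix or vector with a set index denotes the submatrix/subvector of the rows with these indices. Polytopes. For $\mathcal A\subseteq\mathcal Q$ with $G_{\mathcal A}$ of full row rank, put $\mathcal I=\mathcal Q\setminus\mathcal A$, $S=E+GH^{-1}F'$, $W=(G_{\mathcal A}H^{-1}(G_{\mathcal A})')^{-1}$ and $\Pi(\mathcal A)=\{x\in\mathbb R^n\mid Tx\le d\}$ with $$T=\begin{pmatrix}WS_{\mathcal A} \\ G_{\mathcal I}H^{-1}(G_{\mathcal A})'WS_{\mathcal A}-S_{\mathcal I}\end{pmatrix},\quad d=-\begin{pmatrix}Ww_{\mathcal A} \\ G_{\mathcal I}H^{-1}(G_{\mathcal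 A})'Ww_{\mathcal A}-w_{\mathcal I}\end{pmatrix}$$ (for $\mathcal A=\emptyset$ the terms involving $\mathcal A$ are absent). The same definition is used with $\mathcal A'$ in place of $\mathcal A$. *)

theory Defs
  imports
    "HOL-Analysis.Abstract_Euclidean_Space"
    "Jordan_Normal_Form.Matrix"
    "Jordan_Normal_Form.Gauss_Jordan_Elimination"
    "Jordan_Normal_Form.Char_Poly"
    "Jordan_Normal_Form.DL_Rank"
    "Jordan_Normal_Form.DL_Submatrix"
begin

unbundle no vec_syntax and no inner_syntax

section \<open>Vectors and matrices\<close>

text \<open>The usual topology on the vectors of dimension \<open>n\<close>, transported from
  \<^const>\<open>Euclidean_space\<close>.\<close>

definition vec_topology :: "nat \<Rightarrow> real vec topology" where
  "vec_topology n =
     pullback_topology (carrier_vec n) (\<lambda>v i. if i < n then v $ i else 0) (Euclidean_space n)"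

definition pos_semidef :: "nat \<Rightarrow> real mat \<Rightarrow> bool" where
  "pos_semidef n M \<longleftrightarrow> M \<in> carrier_mat n n \<and> M\<^sup>T = M \<and>
     (\<forall>v \<in> carrier_vec n. 0 \<le> v \<bullet> (M *\<^sub>v v))"

definition pos_def :: "nat \<Rightarrow> real mat \<Rightarrow> bool" where
  "pos_def n M \<longleftrightarrow> M \<in> carrier_mat n n \<and> M\<^sup>T = M \<and>
     (\<forall>v \<in> carrier_vec n. v \<noteq> 0\<^sub>v n \<longrightarrow> 0 < v \<bullet> (M *\<^sub>v v))"

definition psd_sqrt :: "nat \<Rightarrow> real mat \<Rightarrow> real mat" where
  "psd_sqrt n M = (THE L. pos_semidef n L \<and> L * L = M)"

text \<open>Meaningful for invertible matrices only.\<close>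

definition inv_mat :: "real mat \<Rightarrow> real mat" where
  "inv_mat M = the (mat_inverse M)"

abbreviation mat_rows :: "real mat \<Rightarrow> nat set \<Rightarrow> real mat" where
  "mat_rows M I \<equiv> submatrix M I UNIV"

definition vec_rows :: "real vec \<Rightarrow> nat set \<Rightarrow> real vec" where
  "vec_rows v I = vec (card {i. i < dim_vec v \<and> i \<in> I}) (\<lambda>i. v $ pick I i)"

text \<open>The first argument of \<^const>\<open>vec_space.rank\<close> is the number of rows.\<close>

definition full_row_rank :: "real mat \<Rightarrow> bool" where
  "full_row_rank M \<longleftrightarrow> vec_space.rank (dim_row M) M = dim_row M"

section \<open>Linear systems\<close>

definition schur_stable :: "real mat \<Rightarrow> bool" where
  "schur_stable M \<longleftrightarrow> (\<forall>z. eigenvalue (map_mat complex_of_real M) z \<longrightarrow> cmod z < 1)"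

definition stabilizable :: "real mat \<Rightarrow> real mat \<Rightarrow> bool" where
  "stabilizable A B \<longleftrightarrow> (\<exists>K \<in> carrier_mat (dim_col B) (dim_row A). schur_stable (A + B * K))"

definition detectable :: "real mat \<Rightarrow> real mat \<Rightarrow> bool" where
  "detectable C A \<longleftrightarrow> (\<exists>L \<in> carrier_mat (dim_row A) (dim_row C). schur_stable (A + L * C))"

section \<open>Polytopes given by halfspaces\<close>

definition polytope :: "nat \<Rightarrow> real mat \<Rightarrow> real vec \<Rightarrow> real vec set" where
  "polytope n M b = {v \<in> carrier_vec n. M *\<^sub>v v \<le> b}"

text \<open>Every row of \<open>M\<close> is the (nonzero) normal vector of a halfspace; the halfspaces need not be
  irredundant.\<close>

definition halfspaces :: "nat \<Rightarrow> real mat \<Rightarrow> real vec \<Rightarrow> bool" where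
  "halfspaces n M b \<longleftrightarrow> M \<in> carrier_mat (dim_row M) n \<and> b \<in> carrier_vec (dim_row M) \<and>
     (\<forall>i < dim_row M. row M i \<noteq> 0\<^sub>v n)"

definition compact_polytope_around_0 :: "nat \<Rightarrow> real mat \<Rightarrow> real vec \<Rightarrow> bool" where
  "compact_polytope_around_0 n M b \<longleftrightarrow> halfspaces n M b \<and>
     compactin (vec_topology n) (polytope n M b) \<and>
     0\<^sub>v n \<in> vec_topology n interior_of (polytope n M b)"

section \<open>The optimal control problem\<close>

text \<open>The sets \<open>\<U>\<close>, \<open>\<X>\<close>, \<open>\<T>\<close> are \<open>polytope m matU vecU\<close>, \<open>polytope n matX vecX\<close> and
  \<open>polytope n matT vecT\<close>, where \<open>n = dim_x\<close> and \<open>m = dim_u\<close>.\<close>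

record mpc =
  dim_x :: nat
  dim_u :: nat
  horizon :: nat
  sysA :: "real mat"
  sysB :: "real mat"
  wtQ :: "real mat"
  wtR :: "real mat"
  wtP :: "real mat"
  matU :: "real mat"
  vecU :: "real vec"
  matX :: "real mat"
  vecX :: "real vec"
  matT :: "real mat"
  vecT :: "real vec"

definition dare :: "mpc \<Rightarrow> bool" where
  "dare S \<longleftrightarrow>
    (let A = sysA S; B = sysB S; P = wtP S in
      P = A\<^sup>T * P * A - A\<^sup>T * P * B * inv_mat (wtR S + B\<^sup>T * P * B) * (B\<^sup>T * P * A) + wtQ S)"

definition lqr_gain :: "mpc \<Rightarrow> real mat" where
  "lqr_gain S =
    (let A = sysA S; B = sysB S; P = wtP S in
      - (inv_mat (wtR S + B\<^sup>T * P * B) * (B\<^sup>T * P * A)))"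

definition lqr_state :: "mpc \<Rightarrow> real vec \<Rightarrow> nat \<Rightarrow> real vec" where
  "lqr_state S x k = (sysA S + sysB S * lqr_gain S) ^\<^sub>m k *\<^sub>v x"

text \<open>Initial states from which the closed loop converges to the origin while all state and input
  constraints hold with strict inequality. (The order \<open><\<close> on vectors is not componentwise strict.)\<close>

definition lqr_inactive_set :: "mpc \<Rightarrow> real vec set" where
  "lqr_inactive_set S = {x \<in> carrier_vec (dim_x S).
     limitin (vec_topology (dim_x S)) (lqr_state S x) (0\<^sub>v (dim_x S)) sequentially \<and>
     (\<forall>k. (\<forall>i < dim_row (matX S). (matX S *\<^sub>v lqr_state S x k) $ i < vecX S $ i) \<and>
          (\<forall>i < dim_row (matU S).
             (matU S *\<^sub>v (lqr_gain S *\<^sub>v lqr_state S x k)) $ i < vecU S $ i))}"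

locale mpc_assumptions =
  fixes S :: mpc
  assumes horizon_ge_2: "2 \<le> horizon S"
    and sysA_carrier: "sysA S \<in> carrier_mat (dim_x S) (dim_x S)"
    and sysB_carrier: "sysB S \<in> carrier_mat (dim_x S) (dim_u S)"
    and stabilizable: "stabilizable (sysA S) (sysB S)"
    and detectable: "detectable (psd_sqrt (dim_x S) (wtQ S)) (sysA S)"
    and wtQ_psd: "pos_semidef (dim_x S) (wtQ S)"
    and wtR_pd: "pos_def (dim_u S) (wtR S)"
    and wtP_pd: "pos_def (dim_x S) (wtP S)"
    and wtP_dare: "dare S"
    and polytope_U: "compact_polytope_around_0 (dim_u S) (matU S) (vecU S)"
    and polytope_X: "compact_polytope_around_0 (dim_x S) (matX S) (vecX S)"
    and polytope_T: "compact_polytope_around_0 (dim_x S) (matT S) (vecT S)"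
    and T_subset_X: "polytope (dim_x S) (matT S) (vecT S) \<subseteq> polytope (dim_x S) (matX S) (vecX S)"
    and T_closure: "polytope (dim_x S) (matT S) (vecT S) =
      Abstract_Topology.closure_of (vec_topology (dim_x S))
        (vec_topology (dim_x S) interior_of (lqr_inactive_set S))"

text \<open>A stacked input vector \<open>U\<close> has dimension \<open>m * N\<close>, its entry \<open>k * m + i\<close> being entry \<open>i\<close>
  of \<open>u(k)\<close>.\<close>

definition input_mat :: "mpc \<Rightarrow> nat \<Rightarrow> real mat" where
  "input_mat S k = mat (dim_u S) (dim_u S * horizon S)
     (\<lambda>(i, c). if c = k * dim_u S + i then 1 else 0)"

fun state :: "mpc \<Rightarrow> real vec \<Rightarrow> real vec \<Rightarrow> nat \<Rightarrow> real vec" where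
  "state S x U 0 = x"
| "state S x U (Suc k) = sysA S *\<^sub>v state S x U k + sysB S *\<^sub>v (input_mat S k *\<^sub>v U)"

definition ocp_feasible :: "mpc \<Rightarrow> real vec \<Rightarrow> real vec \<Rightarrow> bool" where
  "ocp_feasible S x U \<longleftrightarrow>
     (\<forall>k < horizon S. state S x U k \<in> polytope (dim_x S) (matX S) (vecX S) \<and>
        input_mat S k *\<^sub>v U \<in> polytope (dim_u S) (matU S) (vecU S)) \<and>
     state S x U (horizon S) \<in> polytope (dim_x S) (matT S) (vecT S)"

definition ocp_cost :: "mpc \<Rightarrow> real vec \<Rightarrow> real vec \<Rightarrow> real" where
  "ocp_cost S x U =
     (let N = horizon S in
       state S x U N \<bullet> (wtP S *\<^sub>v state S x U N) +
       (\<Sum>k<N. state S x U k \<bullet> (wtQ S *\<^sub>v state S x U k) +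
          (input_mat S k *\<^sub>v U) \<bullet> (wtR S *\<^sub>v (input_mat S k *\<^sub>v U))))"

section \<open>The quadratic program\<close>

text \<open>The matrix \<open>(A\<^sup>k\<^sup>-\<^sup>1B \<dots> AB B 0 \<dots> 0)\<close>, so that
  \<open>x(k) = A\<^sup>k x(0) + pred_mat S k U\<close>.\<close>

definition pred_mat :: "mpc \<Rightarrow> nat \<Rightarrow> real mat" where
  "pred_mat S k = mat (dim_x S) (dim_u S * horizon S)
     (\<lambda>(i, c). let j = c div dim_u S; l = c mod dim_u S in
        if j < k then (sysA S ^\<^sub>m (k - 1 - j) * sysB S) $$ (i, l) else 0)"

definition qpH :: "mpc \<Rightarrow> real mat" where
  "qpH S = (let N = horizon S in mat (dim_u S * N) (dim_u S * N) (\<lambda>ij.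
     2 * (((pred_mat S N)\<^sup>T * wtP S * pred_mat S N) $$ ij +
       (\<Sum>k<N. ((pred_mat S k)\<^sup>T * wtQ S * pred_mat S k) $$ ij +
                ((input_mat S k)\<^sup>T * wtR S * input_mat S k) $$ ij))))"

definition qpF :: "mpc \<Rightarrow> real mat" where
  "qpF S = (let N = horizon S in mat (dim_x S) (dim_u S * N) (\<lambda>ij.
     2 * (((sysA S ^\<^sub>m N)\<^sup>T * wtP S * pred_mat S N) $$ ij +
       (\<Sum>k<N. ((sysA S ^\<^sub>m k)\<^sup>T * wtQ S * pred_mat S k) $$ ij))))"

definition qpY :: "mpc \<Rightarrow> real mat" where
  "qpY S = (let N = horizon S in mat (dim_x S) (dim_x S) (\<lambda>ij.
     2 * (((sysA S ^\<^sub>m N)\<^sup>T * wtP S * (sysA S ^\<^sub>m N)) $$ ij +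
       (\<Sum>k<N. ((sysA S ^\<^sub>m k)\<^sup>T * wtQ S * (sysA S ^\<^sub>m k)) $$ ij))))"

text \<open>Stage \<open>k\<close> contributes the constraints \<open>u(k) \<in> \<U>\<close> followed by \<open>x(k+1) \<in> \<X>\<close>, or by
  \<open>x(N) \<in> \<T>\<close> if \<open>k + 1 = N\<close>. The constraints \<open>x(0) \<in> \<X>\<close> come last.\<close>

definition stage_mat :: "mpc \<Rightarrow> nat \<Rightarrow> real mat" where
  "stage_mat S k = (if Suc k < horizon S then matX S else matT S)"

definition stage_vec :: "mpc \<Rightarrow> nat \<Rightarrow> real vec" where
  "stage_vec S k = (if Suc k < horizon S then vecX S else vecT S)"

definition qpG :: "mpc \<Rightarrow> real mat" where
  "qpG S = foldr (\<lambda>k M. (matU S * input_mat S k) @\<^sub>r (stage_mat S k * pred_mat S (Suc k)) @\<^sub>r M)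
     [0..<horizon S] (0\<^sub>m (dim_row (matX S)) (dim_u S * horizon S))"

definition qpw :: "mpc \<Rightarrow> real vec" where
  "qpw S = foldr (\<lambda>k v. vecU S @\<^sub>v stage_vec S k @\<^sub>v v) [0..<horizon S] (vecX S)"

definition qpE :: "mpc \<Rightarrow> real mat" where
  "qpE S = foldr (\<lambda>k M. 0\<^sub>m (dim_row (matU S)) (dim_x S) @\<^sub>r
       (- (stage_mat S k * sysA S ^\<^sub>m Suc k)) @\<^sub>r M)
     [0..<horizon S] (- matX S)"

definition qp_feasible :: "mpc \<Rightarrow> real vec \<Rightarrow> real vec \<Rightarrow> bool" where
  "qp_feasible S x U \<longleftrightarrow>
     U \<in> carrier_vec (dim_u S * horizon S) \<and> qpG S *\<^sub>v U \<le> qpw S + qpE S *\<^sub>v x"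

definition qp_cost :: "mpc \<Rightarrow> real vec \<Rightarrow> real vec \<Rightarrow> real" where
  "qp_cost S x U =
     1/2 * (U \<bullet> (qpH S *\<^sub>v U)) + x \<bullet> (qpF S *\<^sub>v U) + 1/2 * (x \<bullet> (qpY S *\<^sub>v x))"

definition qp_solution :: "mpc \<Rightarrow> real vec \<Rightarrow> real vec \<Rightarrow> bool" where
  "qp_solution S x U \<longleftrightarrow> qp_feasible S x U \<and>
     (\<forall>V. qp_feasible S x V \<longrightarrow> qp_cost S x U \<le> qp_cost S x V)"

definition qp_opt :: "mpc \<Rightarrow> real vec \<Rightarrow> real vec" where
  "qp_opt S x = (THE U. qp_solution S x U)"

definition feasible_states :: "mpc \<Rightarrow> real vec set" where
  "feasible_states S = {x \<in> carrier_vec (dim_x S). \<exists>U. qp_solution S x U}"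

subsection \<open>Equivalence with the optimal control problem\<close>

context mpc_assumptions
begin

abbreviation "n \<equiv> dim_x S"
abbreviation "m \<equiv> dim_u S"
abbreviation "N \<equiv> horizon S"

lemma input_mat_carrier [simp]: "input_mat S k \<in> carrier_mat m (m * N)"
  by (simp add: input_mat_def)

lemma pred_mat_carrier [simp]: "pred_mat S k \<in> carrier_mat n (m * N)"
  by (simp add: pred_mat_def)

lemma power_carrier [simp]: "sysA S ^\<^sub>m k \<in> carrier_mat n n"
  using sysA_carrier by (rule pow_carrier_mat)

lemma power_Suc_left: "sysA S ^\<^sub>m Suc k = sysA S * sysA S ^\<^sub>m k"
proof (induction k)
  case 0
  then show ?case using sysA_carrier by simp
next
  case (Suc k)
  have "sysA S ^\<^sub>m Suc (Suc k) = sysA S * sysA S ^\<^sub>m k * sysA S"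
    using Suc by simp
  also have "\<dots> = sysA S * (sysA S ^\<^sub>m k * sysA S)"
    using sysA_carrier power_carrier[of k] by (intro assoc_mult_mat)
  finally show ?case by simp
qed

lemma pred_mat_Suc:
  assumes "k < N"
  shows "pred_mat S (Suc k) = sysA S * pred_mat S k + sysB S * input_mat S k"
proof (rule eq_matI)
  fix i c
  assume "i < dim_row (sysA S * pred_mat S k + sysB S * input_mat S k)"
    and "c < dim_col (sysA S * pred_mat S k + sysB S * input_mat S k)"
  then have i: "i < n" and c: "c < m * N"
    using sysB_carrier by (auto simp: input_mat_def)
  then have m: "0 < m" by (cases m) auto
  define j l where "j = c div m" and "l = c mod m"
  have l: "l < m" using m by (simp add: l_def)
  have cjl: "c = j * m + l" by (simp add: j_def l_def)
  have A: "(sysA S * pred_mat S k) $$ (i, c) =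
      (if j < k then (sysA S ^\<^sub>m (k - j) * sysB S) $$ (i, l) else 0)"
  proof -
    have "(sysA S * pred_mat S k) $$ (i, c) = row (sysA S) i \<bullet> col (pred_mat S k) c"
      using i c sysA_carrier by (simp add: pred_mat_def)
    also have "col (pred_mat S k) c =
       (if j < k then col (sysA S ^\<^sub>m (k - 1 - j) * sysB S) l else 0\<^sub>v n)"
    proof -
      have "dim_row (sysA S ^\<^sub>m (k - 1 - j) * sysB S) = n"
        "dim_col (sysA S ^\<^sub>m (k - 1 - j) * sysB S) = m"
        using carrier_matD[OF power_carrier] carrier_matD[OF sysB_carrier] by auto
      then show ?thesis
        using c l by (auto simp: pred_mat_def j_def l_def Let_def simp del: index_mult_mat intro!: eq_vecI)
    qed
    also have "row (sysA S) i \<bullet> \<dots> = 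
       (if j < k then (sysA S * (sysA S ^\<^sub>m (k - 1 - j) * sysB S)) $$ (i, l) else 0)"
      using i l sysA_carrier sysB_carrier by auto
    also have "sysA S * (sysA S ^\<^sub>m (k - 1 - j) * sysB S) = sysA S ^\<^sub>m Suc (k - 1 - j) * sysB S"
      unfolding power_Suc_left
      using sysA_carrier sysB_carrier power_carrier[of "k - 1 - j"]
      by (metis assoc_mult_mat)
    finally show ?thesis by (cases "j < k") (auto simp: Suc_diff_Suc)
  qed
  have B: "(sysB S * input_mat S k) $$ (i, c) = (if j = k then sysB S $$ (i, l) else 0)"
  proof -
    have eq: "c = k * m + i' \<longleftrightarrow> j = k \<and> i' = l" if "i' < m" for i'
      using that m by (auto simp: j_def l_def)
    have "(sysB S * input_mat S k) $$ (i, c) =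
        (\<Sum>i' = 0..<m. sysB S $$ (i, i') * (if c = k * m + i' then 1 else 0))"
      using i c sysB_carrier by (auto simp: input_mat_def scalar_prod_def row_def col_def)
    also have "\<dots> = (\<Sum>i' = 0..<m. if i' = l then (if j = k then sysB S $$ (i, l) else 0) else 0)"
      by (intro sum.cong) (auto simp: eq)
    also have "\<dots> = (if j = k then sysB S $$ (i, l) else 0)"
      using l by simp
    finally show ?thesis .
  qed
  have "pred_mat S (Suc k) $$ (i, c) =
     (if j < Suc k then (sysA S ^\<^sub>m (k - j) * sysB S) $$ (i, l) else 0)"
    using i c by (simp add: pred_mat_def j_def l_def Let_def)
  also have "\<dots> = (sysA S * pred_mat S k) $$ (i, c) + (sysB S * input_mat S k) $$ (i, c)"
    unfolding A B using i l sysB_carrier sysA_carrier by (cases "j = k") auto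
  finally show "pred_mat S (Suc k) $$ (i, c) =
      (sysA S * pred_mat S k + sysB S * input_mat S k) $$ (i, c)"
    using i c sysA_carrier sysB_carrier by (auto simp: input_mat_def)
qed (use sysA_carrier sysB_carrier in \<open>auto simp: pred_mat_def input_mat_def\<close>)

lemma state_eq:
  assumes x: "x \<in> carrier_vec n" and U: "U \<in> carrier_vec (m * N)" and k: "k \<le> N"
  shows "state S x U k = sysA S ^\<^sub>m k *\<^sub>v x + pred_mat S k *\<^sub>v U"
  using k
proof (induction k)
  case 0
  have "pred_mat S 0 = 0\<^sub>m n (m * N)" by (auto simp: pred_mat_def)
  moreover have "0\<^sub>m n (m * N) *\<^sub>v U = 0\<^sub>v n" using U by auto
  ultimately show ?case using x sysA_carrier by simp
next
  case (Suc k)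
  have "sysA S *\<^sub>v (sysA S ^\<^sub>m k *\<^sub>v x + pred_mat S k *\<^sub>v U) =
      sysA S *\<^sub>v (sysA S ^\<^sub>m k *\<^sub>v x) + sysA S *\<^sub>v (pred_mat S k *\<^sub>v U)"
    using x U by (intro mult_add_distrib_mat_vec[OF sysA_carrier] mult_mat_vec_carrier) auto
  also have "sysA S *\<^sub>v (sysA S ^\<^sub>m k *\<^sub>v x) = sysA S ^\<^sub>m Suc k *\<^sub>v x"
    unfolding power_Suc_left by (rule assoc_mult_mat_vec[OF sysA_carrier power_carrier x, symmetric])
  also have "sysA S *\<^sub>v (pred_mat S k *\<^sub>v U) = (sysA S * pred_mat S k) *\<^sub>v U"
    by (rule assoc_mult_mat_vec[OF sysA_carrier pred_mat_carrier U, symmetric])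
  finally have "state S x U (Suc k) = (sysA S ^\<^sub>m Suc k *\<^sub>v x + (sysA S * pred_mat S k) *\<^sub>v U) +
      (sysB S * input_mat S k) *\<^sub>v U"
    using Suc assoc_mult_mat_vec[OF sysB_carrier input_mat_carrier U] by simp
  also have "\<dots> = sysA S ^\<^sub>m Suc k *\<^sub>v x + ((sysA S * pred_mat S k) *\<^sub>v U + (sysB S * input_mat S k) *\<^sub>v U)"
    using x U sysA_carrier sysB_carrier power_carrier[of "Suc k"]
    by (intro assoc_add_vec[of _ n] mult_mat_vec_carrier[of _ _ "m * N"] mult_mat_vec_carrier[of _ n n] mult_carrier_mat[of _ _ n] mult_carrier_mat[of _ _ m]) auto
  also have "(sysA S * pred_mat S k) *\<^sub>v U + (sysB S * input_mat S k) *\<^sub>v U = pred_mat S (Suc k) *\<^sub>v U"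
    unfolding pred_mat_Suc[OF Suc_le_lessD[OF Suc.prems]]
    using sysA_carrier sysB_carrier U
    by (intro add_mult_distrib_mat_vec[symmetric] mult_carrier_mat[of _ _ n] mult_carrier_mat[of _ _ m]) auto
  finally show ?case .
qed

lemma halfspace_carriers:
  "matU S \<in> carrier_mat (dim_row (matU S)) m" "vecU S \<in> carrier_vec (dim_row (matU S))"
  "matX S \<in> carrier_mat (dim_row (matX S)) n" "vecX S \<in> carrier_vec (dim_row (matX S))"
  "stage_mat S k \<in> carrier_mat (dim_row (stage_mat S k)) n"
  "stage_vec S k \<in> carrier_vec (dim_row (stage_mat S k))"
  using polytope_U polytope_X polytope_T
  by (auto simp: compact_polytope_around_0_def halfspaces_def stage_mat_def stage_vec_def)

lemma stacked_constraints:
  assumes x: "x \<in> carrier_vec n" and U: "U \<in> carrier_vec (m * N)" and ks: "set ks \<subseteq> {..<N}"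
  defines "G \<equiv> foldr (\<lambda>k M. (matU S * input_mat S k) @\<^sub>r (stage_mat S k * pred_mat S (Suc k)) @\<^sub>r M)
       ks (0\<^sub>m (dim_row (matX S)) (m * N))"
    and "w \<equiv> foldr (\<lambda>k v. vecU S @\<^sub>v stage_vec S k @\<^sub>v v) ks (vecX S)"
    and "E \<equiv> foldr (\<lambda>k M. 0\<^sub>m (dim_row (matU S)) n @\<^sub>r
       (- (stage_mat S k * sysA S ^\<^sub>m Suc k)) @\<^sub>r M) ks (- matX S)"
  shows "(G \<in> carrier_mat (dim_row G) (m * N) \<and> w \<in> carrier_vec (dim_row G) \<and>
      E \<in> carrier_mat (dim_row G) n) \<and> (G *\<^sub>v U \<le> w + E *\<^sub>v x \<longleftrightarrow>
     (\<forall>k \<in> set ks. matU S *\<^sub>v (input_mat S k *\<^sub>v U) \<le> vecU S \<and>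
        stage_mat S k *\<^sub>v state S x U (Suc k) \<le> stage_vec S k) \<and> matX S *\<^sub>v x \<le> vecX S)"
  unfolding assms(4-6) using ks
proof (induction ks)
  case Nil
  note X = halfspace_carriers(3) and b = halfspace_carriers(4)
  have 0: "0\<^sub>m (dim_row (matX S)) (m * N) *\<^sub>v U = 0\<^sub>v (dim_row (matX S))"
    using U by auto
  have neg: "- matX S *\<^sub>v x = - (matX S *\<^sub>v x)"
    using carrier_matD(2)[OF X] carrier_vecD[OF x] by (intro eq_vecI) auto
  have le: "0\<^sub>v (dim_row (matX S)) \<le> vecX S + - (matX S *\<^sub>v x) \<longleftrightarrow> matX S *\<^sub>v x \<le> vecX S"
    using carrier_vecD[OF b] by (simp add: less_eq_vec_def)
  show ?case
    unfolding foldr.simps id_apply index_zero_mat 0 neg le list.set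
    using zero_carrier_mat uminus_carrier_iff_mat[THEN iffD2, OF X] b by blast
next
  case (Cons k ks)
  let ?G = "foldr (\<lambda>k M. (matU S * input_mat S k) @\<^sub>r (stage_mat S k * pred_mat S (Suc k)) @\<^sub>r M)
       ks (0\<^sub>m (dim_row (matX S)) (m * N))"
  let ?w = "foldr (\<lambda>k v. vecU S @\<^sub>v stage_vec S k @\<^sub>v v) ks (vecX S)"
  let ?E = "foldr (\<lambda>k M. 0\<^sub>m (dim_row (matU S)) n @\<^sub>r
       (- (stage_mat S k * sysA S ^\<^sub>m Suc k)) @\<^sub>r M) ks (- matX S)"
  define q where "q = dim_row ?G"
  define u where "u = dim_row (matU S)"
  define s where "s = dim_row (stage_mat S k)"
  note hc = halfspace_carriers(1,2)[folded u_def] halfspace_carriers(5,6)[of k, folded s_def]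
  from Cons.prems have k: "k < N" and ks: "set ks \<subseteq> {..<N}" by auto
  have G: "?G \<in> carrier_mat q (m * N)" and w: "?w \<in> carrier_vec q"
    and E: "?E \<in> carrier_mat q n" and IH: "?G *\<^sub>v U \<le> ?w + ?E *\<^sub>v x \<longleftrightarrow>
     (\<forall>k \<in> set ks. matU S *\<^sub>v (input_mat S k *\<^sub>v U) \<le> vecU S \<and>
        stage_mat S k *\<^sub>v state S x U (Suc k) \<le> stage_vec S k) \<and> matX S *\<^sub>v x \<le> vecX S"
    using Cons.IH[OF ks, folded q_def] by blast+
  let ?G1 = "matU S * input_mat S k" and ?G2 = "stage_mat S k * pred_mat S (Suc k)"
  let ?E2 = "- (stage_mat S k * sysA S ^\<^sub>m Suc k)"
  have G1: "?G1 \<in> carrier_mat u (m * N)" and G2: "?G2 \<in> carrier_mat s (m * N)"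
    by (rule mult_carrier_mat[OF hc(1) input_mat_carrier], rule mult_carrier_mat[OF hc(3) pred_mat_carrier])
  have SA: "stage_mat S k * sysA S ^\<^sub>m Suc k \<in> carrier_mat s n"
    using hc(3) power_carrier[of "Suc k"] by (rule mult_carrier_mat)
  then have E2: "?E2 \<in> carrier_mat s n" by simp
  let ?E1 = "0\<^sub>m (dim_row (matU S)) n"
  have E1: "?E1 \<in> carrier_mat u n" by (simp add: u_def)
  have x1: "?E1 *\<^sub>v x = 0\<^sub>v u" using x by (auto simp: u_def)
  have Ex: "(?E1 @\<^sub>r ?E2 @\<^sub>r ?E) *\<^sub>v x = 0\<^sub>v u @\<^sub>v (?E2 *\<^sub>v x) @\<^sub>v (?E *\<^sub>v x)"
    using mat_mult_append[OF E1 carrier_append_rows[OF E2 E] x] mat_mult_append[OF E2 E x] x1 by simp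
  have rhs: "(vecU S @\<^sub>v stage_vec S k @\<^sub>v ?w) + (?E1 @\<^sub>r ?E2 @\<^sub>r ?E) *\<^sub>v x =
     vecU S @\<^sub>v (stage_vec S k + ?E2 *\<^sub>v x) @\<^sub>v (?w + ?E *\<^sub>v x)"
  proof -
    have "(vecU S @\<^sub>v (stage_vec S k @\<^sub>v ?w)) + (0\<^sub>v u @\<^sub>v ((?E2 *\<^sub>v x) @\<^sub>v (?E *\<^sub>v x))) =
        (vecU S + 0\<^sub>v u) @\<^sub>v ((stage_vec S k @\<^sub>v ?w) + ((?E2 *\<^sub>v x) @\<^sub>v (?E *\<^sub>v x)))"
      by (rule append_vec_add[OF hc(2) zero_carrier_vec append_carrier_vec[OF hc(4) w]
          append_carrier_vec[OF mult_mat_vec_carrier[OF E2 x] mult_mat_vec_carrier[OF E x]]])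
    also have "(stage_vec S k @\<^sub>v ?w) + ((?E2 *\<^sub>v x) @\<^sub>v (?E *\<^sub>v x)) =
        (stage_vec S k + ?E2 *\<^sub>v x) @\<^sub>v (?w + ?E *\<^sub>v x)"
      by (rule append_vec_add[OF hc(4) mult_mat_vec_carrier[OF E2 x] w mult_mat_vec_carrier[OF E x]])
    also have "vecU S + 0\<^sub>v u = vecU S" by (rule right_zero_vec[OF hc(2)])
    finally show ?thesis unfolding Ex .
  qed
  have "(?G1 @\<^sub>r ?G2 @\<^sub>r ?G) *\<^sub>v U \<le> (vecU S @\<^sub>v stage_vec S k @\<^sub>v ?w) + (?E1 @\<^sub>r ?E2 @\<^sub>r ?E) *\<^sub>v x \<longleftrightarrow>
     ?G1 *\<^sub>v U \<le> vecU S \<and> ?G2 *\<^sub>v U \<le> stage_vec S k + ?E2 *\<^sub>v x \<and> ?G *\<^sub>v U \<le> ?w + ?E *\<^sub>v x"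
    unfolding rhs
    using append_rows_le[OF G1 carrier_append_rows[OF G2 G] hc(2) U]
      append_rows_le[OF G2 G _ U, of "stage_vec S k + ?E2 *\<^sub>v x"] hc(4) E2 x by auto
  moreover have "?G1 *\<^sub>v U = matU S *\<^sub>v (input_mat S k *\<^sub>v U)"
    by (rule assoc_mult_mat_vec[OF hc(1) input_mat_carrier U])
  moreover have "?G2 *\<^sub>v U \<le> stage_vec S k + ?E2 *\<^sub>v x \<longleftrightarrow>
      stage_mat S k *\<^sub>v state S x U (Suc k) \<le> stage_vec S k"
  proof -
    have "stage_mat S k *\<^sub>v state S x U (Suc k) =
       (stage_mat S k * sysA S ^\<^sub>m Suc k) *\<^sub>v x + ?G2 *\<^sub>v U"
      unfolding state_eq[OF x U Suc_leI[OF k]] assoc_mult_mat_vec[OF hc(3) power_carrier x]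
        assoc_mult_mat_vec[OF hc(3) pred_mat_carrier U]
      using x U power_carrier[of "Suc k"]
      by (intro mult_add_distrib_mat_vec[OF hc(3)] mult_mat_vec_carrier[of _ n "m * N"] mult_mat_vec_carrier[of _ n n]) auto
    moreover have "?E2 *\<^sub>v x = - ((stage_mat S k * sysA S ^\<^sub>m Suc k) *\<^sub>v x)"
      using SA x by (auto intro!: eq_vecI)
    ultimately show ?thesis
      using SA x U G2 hc(4) by (auto simp: less_eq_vec_def algebra_simps)
  qed
  moreover have "?G1 @\<^sub>r ?G2 @\<^sub>r ?G \<in> carrier_mat (u + (s + q)) (m * N)"
    "?E1 @\<^sub>r ?E2 @\<^sub>r ?E \<in> carrier_mat (u + (s + q)) n"
    using G1 G2 G E1 E2 E by (auto intro!: carrier_append_rows)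
  moreover have "vecU S @\<^sub>v stage_vec S k @\<^sub>v ?w \<in> carrier_vec (u + (s + q))"
    using hc(2) hc(4) w by auto
  ultimately show ?case using IH by auto
qed

lemma qp_feasible_iff:
  assumes x: "x \<in> carrier_vec n" and U: "U \<in> carrier_vec (m * N)"
  shows "qp_feasible S x U \<longleftrightarrow> ocp_feasible S x U"
proof -
  have N: "0 < N" using horizon_ge_2 by simp
  have st: "state S x U k \<in> carrier_vec n" if "k \<le> N" for k
    unfolding state_eq[OF x U that] using x U power_carrier[of k] pred_mat_carrier[of k]
    by (metis add_carrier_vec mult_mat_vec_carrier)
  have inp: "input_mat S k *\<^sub>v U \<in> carrier_vec m" for k
    using U by (metis input_mat_carrier mult_mat_vec_carrier)
  have "qp_feasible S x U \<longleftrightarrow> (\<forall>k<N. matU S *\<^sub>v (input_mat S k *\<^sub>v U) \<le> vecU S \<and>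
        stage_mat S k *\<^sub>v state S x U (Suc k) \<le> stage_vec S k) \<and> matX S *\<^sub>v x \<le> vecX S"
    using stacked_constraints[OF x U, of "[0..<N]"] U
    by (auto simp: qp_feasible_def qpG_def qpw_def qpE_def atLeast0LessThan)
  also have "\<dots> \<longleftrightarrow> ocp_feasible S x U"
  proof
    assume *: "(\<forall>k<N. matU S *\<^sub>v (input_mat S k *\<^sub>v U) \<le> vecU S \<and>
        stage_mat S k *\<^sub>v state S x U (Suc k) \<le> stage_vec S k) \<and> matX S *\<^sub>v x \<le> vecX S"
    have "matX S *\<^sub>v state S x U k \<le> vecX S" if "k < N" for k
      using * that by (cases k) (auto simp: stage_mat_def stage_vec_def dest!: spec[of _ "k - 1"])
    moreover have "matT S *\<^sub>v state S x U N \<le> vecT S"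
      using * N by (cases N) (auto simp: stage_mat_def stage_vec_def dest!: spec[of _ "N - 1"])
    ultimately show "ocp_feasible S x U" using * st inp by (simp add: ocp_feasible_def polytope_def)
  next
    assume *: "ocp_feasible S x U"
    have "stage_mat S k *\<^sub>v state S x U (Suc k) \<le> stage_vec S k" if "k < N" for k
    proof (cases "Suc k = N")
      case True
      then show ?thesis using * by (auto simp: ocp_feasible_def polytope_def stage_mat_def stage_vec_def simp del: state.simps)
    next
      case False
      then have "Suc k < N" using that by simp
      then show ?thesis using * by (auto simp: ocp_feasible_def polytope_def stage_mat_def stage_vec_def simp del: state.simps)
    qed
    moreover have "matX S *\<^sub>v x \<le> vecX S"
      using * N by (auto simp: ocp_feasible_def polytope_def dest!: spec[of _ 0])
    ultimately show "(\<forall>k<N. matU S *\<^sub>v (input_mat S k *\<^sub>v U) \<le> vecU S \<and>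
        stage_mat S k *\<^sub>v state S x U (Suc k) \<le> stage_vec S k) \<and> matX S *\<^sub>v x \<le> vecX S"
      using * by (simp add: ocp_feasible_def polytope_def del: state.simps)
  qed
  finally show ?thesis .
qed

lemma form_sum:
  assumes x: "x \<in> carrier_vec a" and y: "y \<in> carrier_vec b"
    and g: "g \<in> carrier_mat a b" and f: "\<And>k. f k \<in> carrier_mat a b"
  shows "x \<bullet> (mat a b (\<lambda>ij. 2 * (g $$ ij + (\<Sum>k<N. f k $$ ij))) *\<^sub>v y) =
    (2::real) * (x \<bullet> (g *\<^sub>v y) + (\<Sum>k<N. x \<bullet> (f k *\<^sub>v y)))"
proof -
  have form: "x \<bullet> (M *\<^sub>v y) = (\<Sum>i<a. \<Sum>j<b. x $ i * M $$ (i, j) * y $ j)"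
    if "M \<in> carrier_mat a b" for M :: "real mat"
    using that x y by (auto simp: scalar_prod_def sum_distrib_left atLeast0LessThan mult.assoc intro!: sum.cong)
  have "(\<Sum>i<a. \<Sum>j<b. \<Sum>k<N. x $ i * f k $$ (i, j) * y $ j) =
     (\<Sum>k<N. \<Sum>i<a. \<Sum>j<b. x $ i * f k $$ (i, j) * y $ j)"
  proof -
    have "(\<Sum>i<a. \<Sum>j<b. \<Sum>k<N. x $ i * f k $$ (i, j) * y $ j) =
      (\<Sum>i<a. \<Sum>k<N. \<Sum>j<b. x $ i * f k $$ (i, j) * y $ j)"
      by (intro sum.cong refl sum.swap)
    also have "\<dots> = (\<Sum>k<N. \<Sum>i<a. \<Sum>j<b. x $ i * f k $$ (i, j) * y $ j)"
      by (rule sum.swap)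
    finally show ?thesis .
  qed
  note swap = this
  have entry: "x $ i * (2 * (g $$ (i, j) + (\<Sum>k<N. f k $$ (i, j)))) * y $ j =
      2 * (x $ i * g $$ (i, j) * y $ j + (\<Sum>k<N. x $ i * f k $$ (i, j) * y $ j))" for i j
  proof -
    have "(\<Sum>k<N. x $ i * f k $$ (i, j) * y $ j) = x $ i * (\<Sum>k<N. f k $$ (i, j)) * y $ j"
      by (simp only: sum_distrib_left sum_distrib_right)
    then show ?thesis by (simp only: algebra_simps)
  qed
  have "x \<bullet> (mat a b (\<lambda>ij. 2 * (g $$ ij + (\<Sum>k<N. f k $$ ij))) *\<^sub>v y) =
      (\<Sum>i<a. \<Sum>j<b. x $ i * (2 * (g $$ (i, j) + (\<Sum>k<N. f k $$ (i, j)))) * y $ j)"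
    by (subst form) (auto intro!: sum.cong)
  also have "\<dots> = 2 * ((\<Sum>i<a. \<Sum>j<b. x $ i * g $$ (i, j) * y $ j) +
      (\<Sum>i<a. \<Sum>j<b. \<Sum>k<N. x $ i * f k $$ (i, j) * y $ j))"
    by (simp only: entry sum.distrib sum_distrib_left[symmetric])
  also have "\<dots> = 2 * (x \<bullet> (g *\<^sub>v y) + (\<Sum>k<N. x \<bullet> (f k *\<^sub>v y)))"
    by (simp only: swap form[OF g] form[OF f])
  finally show ?thesis .
qed

lemma congruence_form:
  assumes "L \<in> carrier_mat r a" "M \<in> carrier_mat r r" "R \<in> carrier_mat r b"
    "x \<in> carrier_vec a" "y \<in> carrier_vec b"
  shows "x \<bullet> ((L\<^sup>T * M * R) *\<^sub>v y) = (L *\<^sub>v x) \<bullet> ((M *\<^sub>v (R *\<^sub>v y)) :: real vec)"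
proof -
  have "(L\<^sup>T * M * R) *\<^sub>v y = L\<^sup>T *\<^sub>v (M *\<^sub>v (R *\<^sub>v y))"
    using assms by (smt (verit) assoc_mult_mat_vec carrier_matD mult_carrier_mat mult_mat_vec_carrier transpose_carrier_mat)
  then have "x \<bullet> ((L\<^sup>T * M * R) *\<^sub>v y) = (L\<^sup>T *\<^sub>v (M *\<^sub>v (R *\<^sub>v y))) \<bullet> x"
    using assms by (metis comm_scalar_prod mult_mat_vec_carrier transpose_carrier_mat)
  also have "\<dots> = (M *\<^sub>v (R *\<^sub>v y)) \<bullet> (L *\<^sub>v x)"
    using assms transpose_vec_mult_scalar[of L r a x "M *\<^sub>v (R *\<^sub>v y)"] by simp
  also have "\<dots> = (L *\<^sub>v x) \<bullet> (M *\<^sub>v (R *\<^sub>v y))"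
    using assms by (metis comm_scalar_prod mult_mat_vec_carrier)
  finally show ?thesis .
qed

lemma square_form_add:
  assumes M: "M \<in> carrier_mat r r" "M\<^sup>T = M" and a: "a \<in> carrier_vec r" and b: "b \<in> carrier_vec r"
  shows "(a + b) \<bullet> (M *\<^sub>v (a + b)) = a \<bullet> (M *\<^sub>v a) + 2 * (a \<bullet> (M *\<^sub>v b)) + b \<bullet> ((M *\<^sub>v b) :: real vec)"
proof -
  have "b \<bullet> (M *\<^sub>v a) = a \<bullet> (M *\<^sub>v b)"
    using transpose_vec_mult_scalar[OF M(1) a b] M a b by (metis comm_scalar_prod mult_mat_vec_carrier)
  moreover have "M *\<^sub>v a \<in> carrier_vec r" "M *\<^sub>v b \<in> carrier_vec r" using M a b by auto
  ultimately show ?thesis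
    using M a b by (simp add: mult_add_distrib_mat_vec[of _ r r] add_scalar_prod_distrib[of _ r] scalar_prod_add_distrib[of _ r])
qed

lemma qp_cost_eq:
  assumes x: "x \<in> carrier_vec n" and U: "U \<in> carrier_vec (m * N)"
  shows "qp_cost S x U = ocp_cost S x U"
proof -
  have Q: "wtQ S \<in> carrier_mat n n" "(wtQ S)\<^sup>T = wtQ S" and P: "wtP S \<in> carrier_mat n n" "(wtP S)\<^sup>T = wtP S"
    and R: "wtR S \<in> carrier_mat m m"
    using wtQ_psd wtP_pd wtR_pd by (auto simp: pos_semidef_def pos_def_def)
  let ?a = "\<lambda>k. sysA S ^\<^sub>m k *\<^sub>v x" and ?b = "\<lambda>k. pred_mat S k *\<^sub>v U" and ?u = "\<lambda>k. input_mat S k *\<^sub>v U"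
  have a: "?a k \<in> carrier_vec n" and b: "?b k \<in> carrier_vec n" for k
    using x U by (metis power_carrier mult_mat_vec_carrier, metis pred_mat_carrier mult_mat_vec_carrier)
  note cc = mult_carrier_mat[OF mult_carrier_mat[OF transpose_carrier_mat[THEN iffD2]]]
  have H: "U \<bullet> (qpH S *\<^sub>v U) = 2 * (?b N \<bullet> (wtP S *\<^sub>v ?b N) +
      (\<Sum>k<N. ?b k \<bullet> (wtQ S *\<^sub>v ?b k) + ?u k \<bullet> (wtR S *\<^sub>v ?u k)))"
  proof -
    have c1: "(pred_mat S k)\<^sup>T * wtQ S * pred_mat S k \<in> carrier_mat (m * N) (m * N)" for k
      by (rule cc[OF pred_mat_carrier Q(1) pred_mat_carrier])
    have c2: "(input_mat S k)\<^sup>T * wtR S * input_mat S k \<in> carrier_mat (m * N) (m * N)" for k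
      by (rule cc[OF input_mat_carrier R input_mat_carrier])
    have dims: "dim_row ((input_mat S k)\<^sup>T * wtR S * input_mat S k) = m * N"
      "dim_col ((input_mat S k)\<^sup>T * wtR S * input_mat S k) = m * N" for k
      using carrier_matD[OF c2] by auto
    have "qpH S = mat (m * N) (m * N) (\<lambda>ij. 2 * (((pred_mat S N)\<^sup>T * wtP S * pred_mat S N) $$ ij +
       (\<Sum>k<N. ((pred_mat S k)\<^sup>T * wtQ S * pred_mat S k + (input_mat S k)\<^sup>T * wtR S * input_mat S k) $$ ij)))"
      using c1 c2 unfolding qpH_def Let_def
      by (intro eq_matI) (auto simp: sum.distrib index_add_mat(1) dims simp del: index_mult_mat)
    moreover have "U \<bullet> ((((pred_mat S k)\<^sup>T * wtQ S * pred_mat S k + (input_mat S k)\<^sup>T * wtR S * input_mat S k)) *\<^sub>v U)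
       = ?b k \<bullet> (wtQ S *\<^sub>v ?b k) + ?u k \<bullet> (wtR S *\<^sub>v ?u k)" for k
    proof -
      have "U \<bullet> ((((pred_mat S k)\<^sup>T * wtQ S * pred_mat S k + (input_mat S k)\<^sup>T * wtR S * input_mat S k)) *\<^sub>v U)
        = U \<bullet> (((pred_mat S k)\<^sup>T * wtQ S * pred_mat S k) *\<^sub>v U) + U \<bullet> (((input_mat S k)\<^sup>T * wtR S * input_mat S k) *\<^sub>v U)"
        unfolding add_mult_distrib_mat_vec[OF c1 c2 U]
        using mult_mat_vec_carrier[OF c1 U] mult_mat_vec_carrier[OF c2 U] U
        by (intro scalar_prod_add_distrib)
      then show ?thesis
        unfolding congruence_form[OF pred_mat_carrier Q(1) pred_mat_carrier U U]
          congruence_form[OF input_mat_carrier R input_mat_carrier U U] .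
    qed
    ultimately show ?thesis
      using form_sum[OF U U cc[OF pred_mat_carrier P(1) pred_mat_carrier], of
          "\<lambda>k. (pred_mat S k)\<^sup>T * wtQ S * pred_mat S k + (input_mat S k)\<^sup>T * wtR S * input_mat S k",
          OF add_carrier_mat[OF c2]]
        congruence_form[OF pred_mat_carrier P(1) pred_mat_carrier U U] by simp
  qed
  have F: "x \<bullet> (qpF S *\<^sub>v U) = 2 * (?a N \<bullet> (wtP S *\<^sub>v ?b N) + (\<Sum>k<N. ?a k \<bullet> (wtQ S *\<^sub>v ?b k)))"
    unfolding qpF_def Let_def
    using form_sum[OF x U cc[OF power_carrier P(1) pred_mat_carrier] cc[OF power_carrier Q(1) pred_mat_carrier]]
      congruence_form[OF power_carrier P(1) pred_mat_carrier x U]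
      congruence_form[OF power_carrier Q(1) pred_mat_carrier x U] by simp
  have Y: "x \<bullet> (qpY S *\<^sub>v x) = 2 * (?a N \<bullet> (wtP S *\<^sub>v ?a N) + (\<Sum>k<N. ?a k \<bullet> (wtQ S *\<^sub>v ?a k)))"
    unfolding qpY_def Let_def
    using form_sum[OF x x cc[OF power_carrier P(1) power_carrier] cc[OF power_carrier Q(1) power_carrier]]
      congruence_form[OF power_carrier P(1) power_carrier x x]
      congruence_form[OF power_carrier Q(1) power_carrier x x] by simp
  show ?thesis
    unfolding qp_cost_def H F Y ocp_cost_def Let_def
    by (simp add: state_eq[OF x U] square_form_add[OF Q a b] square_form_add[OF P a b]
        sum.distrib sum_distrib_left algebra_simps)
qed

end

section \<open>Active sets\<close>

text \<open>Constraints are numbered from 0.\<close>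

definition constraints :: "mpc \<Rightarrow> nat set" where
  "constraints S = {..<dim_row (qpG S)}"

definition stage0_constraints :: "mpc \<Rightarrow> nat set" where
  "stage0_constraints S = {..<dim_row (matU S) + dim_row (matX S)}"

definition active_set :: "mpc \<Rightarrow> real vec \<Rightarrow> nat set" where
  "active_set S x =
     {i \<in> constraints S. row (qpG S) i \<bullet> qp_opt S x = qpw S $ i + row (qpE S) i \<bullet> x}"

definition G11 :: "mpc \<Rightarrow> real mat" where
  "G11 S = submatrix (qpG S) (stage0_constraints S) {..<dim_u S}"

definition qpS :: "mpc \<Rightarrow> real mat" where
  "qpS S = qpE S + qpG S * inv_mat (qpH S) * (qpF S)\<^sup>T"

text \<open>For \<open>\<A> = {}\<close> the products through the index set \<open>\<A>\<close> are zero, and the corresponding blocks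
  of rows are empty.\<close>

definition critical_polytope :: "mpc \<Rightarrow> nat set \<Rightarrow> real vec set" where
  "critical_polytope S \<A> =
    (let \<I> = constraints S - \<A>;
         GA = mat_rows (qpG S) \<A>; GI = mat_rows (qpG S) \<I>; Hi = inv_mat (qpH S);
         SA = mat_rows (qpS S) \<A>; SI = mat_rows (qpS S) \<I>;
         wA = vec_rows (qpw S) \<A>; wI = vec_rows (qpw S) \<I>;
         W = inv_mat (GA * Hi * GA\<^sup>T);
         T = (W * SA) @\<^sub>r (GI * Hi * GA\<^sup>T * W * SA - SI);
         d = - ((W *\<^sub>v wA) @\<^sub>v ((GI * Hi * GA\<^sup>T * W) *\<^sub>v wA - wI))
     in {x \<in> carrier_vec (dim_x S). T *\<^sub>v x \<le> d})"

definition extension_sets :: "mpc \<Rightarrow> nat set \<Rightarrow> nat set set" where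
  "extension_sets S \<A> =
     {\<A>'. \<A>' \<subseteq> constraints S \<and> \<A> \<inter> stage0_constraints S \<subseteq> \<A>' \<and> \<A>' \<subseteq> \<A>}"

end

theory Submission
  imports Defs
begin

text \<open>
  For each state \<open>x\<close> the QP is strictly convex, so a point satisfying the Karush-Kuhn-Tucker
  conditions is its unique solution. The set \<open>\<Pi>(\<A>')\<close> consists of the states for which
  an explicit candidate satisfies them: treating the constraints in \<open>\<A>'\<close> as equalities
  determines \<open>U = - H\<^sup>-\<^sup>1 (F\<^sup>T x + G\<^sub>\<A>\<^sub>'\<^sup>T \<mu>)\<close> with multipliers
  \<open>\<mu> = - W (w\<^sub>\<A>\<^sub>' + S\<^sub>\<A>\<^sub>' x)\<close>, and the two blocks of inequalities defining
  \<open>\<Pi>(\<A>')\<close> are \<open>\<mu> \<ge> 0\<close> and the feasibility of \<open>U\<close> for the other constraints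
  (\<open>parametric_kkt_point\<close>, \<open>critical_polytope_optimal\<close>). This needs \<open>H\<close> to be positive definite,
  which comes from \<open>R\<close> being so (\<open>qpH_pos_def\<close>), and the rows in \<open>\<A>'\<close> to be linearly
  independent, which they inherit from \<open>\<A>\<close> (\<open>left_kernel_mat_rows_subset\<close>).

  So on \<open>\<Pi>(\<A>')\<close> all constraints in \<open>\<A>'\<close> are active at the optimum. Those of stage 0 involve only
  \<open>u(0)\<close> (\<open>stage0_rows_mult\<close>), and they are exactly the stage 0 constraints in \<open>\<A>\<close>, since the
  sets in \<open>\<E>(\<A>)\<close> differ from \<open>\<A>\<close> only in later stages. They thus form a linear system
  \<open>G\<^sup>1\<^sup>1 u(0) = w + E x\<close> (restricted to these rows) with an invertible matrix, and solving it
  gives the feedback law.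
\<close>

section \<open>Invertible and positive definite matrices\<close>

lemma inv_mat_inverse:
  assumes M: "M \<in> carrier_mat k k" and det: "det M \<noteq> 0"
  shows "inv_mat M \<in> carrier_mat k k" "M * inv_mat M = 1\<^sub>m k" "inv_mat M * M = 1\<^sub>m k"
proof -
  have "mat_inverse M \<noteq> None"
    using mat_inverse(1)[OF M, where b = "()"] det_non_zero_imp_unit[OF M det, where b = "()"] by blast
  then obtain B where "mat_inverse M = Some B" by blast
  with mat_inverse(2)[OF M this]
  show "inv_mat M \<in> carrier_mat k k" "M * inv_mat M = 1\<^sub>m k" "inv_mat M * M = 1\<^sub>m k"
    by (simp_all add: inv_mat_def)
qed

lemma invertible_mat_det_nonzero:
  fixes M :: "real mat"
  assumes "invertible_mat M"
  shows "det M \<noteq> 0"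
proof -
  from assms obtain B where sq: "dim_col M = dim_row M"
    and inv: "M * B = 1\<^sub>m (dim_row M)" "B * M = 1\<^sub>m (dim_row B)"
    unfolding invertible_mat_def inverts_mat_def square_mat.simps by blast
  define k where "k = dim_row M"
  have M: "M \<in> carrier_mat k k" unfolding k_def using sq by (intro carrier_matI refl)
  have "dim_col B = k" using arg_cong[OF inv(1), of dim_col] by (simp add: k_def)
  moreover have "dim_row B = k" using arg_cong[OF inv(2), of dim_col] M by simp
  ultimately have B: "B \<in> carrier_mat k k" by auto
  have "det M * det B = det (M * B)" using M B by (simp add: det_mult)
  also have "\<dots> = 1" using inv(1) by simp
  finally show ?thesis by auto
qed

lemma pos_def_det_nonzero:
  assumes "pos_def k M"
  shows "det M \<noteq> 0"
proof
  assume "det M = 0"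
  moreover have M: "M \<in> carrier_mat k k" using assms by (simp add: pos_def_def)
  ultimately obtain v where v: "v \<in> carrier_vec k" "v \<noteq> 0\<^sub>v k" "M *\<^sub>v v = 0\<^sub>v k"
    using det_0_iff_vec_prod_zero[OF M] by blast
  then have "v \<bullet> (M *\<^sub>v v) = 0" by simp
  then show False using assms v(1,2) unfolding pos_def_def by force
qed

lemma pos_def_inv_mat:
  assumes H: "pos_def k H"
  shows "pos_def k (inv_mat H)"
proof -
  have Hc: "H \<in> carrier_mat k k" and Ht: "H\<^sup>T = H" using H by (auto simp: pos_def_def)
  note inv = inv_mat_inverse[OF Hc pos_def_det_nonzero[OF H]]
  let ?L = "inv_mat H"
  have Lt: "?L\<^sup>T \<in> carrier_mat k k" using inv(1) by simp
  have "?L\<^sup>T * H = (H * ?L)\<^sup>T" using transpose_mult[OF Hc inv(1)] Ht by simp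
  then have "?L\<^sup>T * H = 1\<^sub>m k" by (simp add: inv(2))
  then have "?L\<^sup>T = ?L\<^sup>T * (H * ?L)" "(?L\<^sup>T * H) * ?L = ?L" using inv(1) Lt by (simp_all add: inv(2))
  then have sym: "?L\<^sup>T = ?L" using assoc_mult_mat[OF Lt Hc inv(1)] by simp
  have "0 < v \<bullet> (?L *\<^sub>v v)" if v: "v \<in> carrier_vec k" "v \<noteq> 0\<^sub>v k" for v
  proof -
    define y where "y = ?L *\<^sub>v v"
    have y: "y \<in> carrier_vec k" using inv(1) v(1) by (simp add: y_def)
    have Hy: "H *\<^sub>v y = v"
      using assoc_mult_mat_vec[OF Hc inv(1) v(1)] inv(2) v(1) by (simp add: y_def)
    have "y \<noteq> 0\<^sub>v k" using Hy v(2) Hc by auto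
    then have "0 < y \<bullet> (H *\<^sub>v y)" using H y by (simp add: pos_def_def)
    then show ?thesis using Hy comm_scalar_prod[OF v(1) y] by (simp add: y_def)
  qed
  then show ?thesis using inv(1) sym by (simp add: pos_def_def)
qed

text \<open>The quadratic form of \<open>M L M\<^sup>T\<close> at \<open>y\<close> is that of \<open>L\<close> at \<open>M\<^sup>T y\<close>. With \<open>L = H\<^sup>-\<^sup>1\<close> and the active
  rows \<open>M\<close> this makes the matrix inverted in \<open>W\<close> regular.\<close>

lemma pos_def_congruence:
  assumes L: "pos_def k L" and M: "M \<in> carrier_mat p k"
    and ker: "\<And>y. y \<in> carrier_vec p \<Longrightarrow> M\<^sup>T *\<^sub>v y = 0\<^sub>v k \<Longrightarrow> y = 0\<^sub>v p"
  shows "pos_def p (M * L * M\<^sup>T)"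
proof -
  have Lc: "L \<in> carrier_mat k k" and Lt: "L\<^sup>T = L" using L by (auto simp: pos_def_def)
  have MH: "M * L \<in> carrier_mat p k" and Mt: "M\<^sup>T \<in> carrier_mat k p" using M Lc by auto
  have "(M * L * M\<^sup>T)\<^sup>T = M * (L * M\<^sup>T)"
    using transpose_mult[OF MH Mt] transpose_mult[OF M Lc] Lt by simp
  then have sym: "(M * L * M\<^sup>T)\<^sup>T = M * L * M\<^sup>T" using assoc_mult_mat[OF M Lc Mt] by simp
  have "0 < y \<bullet> ((M * L * M\<^sup>T) *\<^sub>v y)" if y: "y \<in> carrier_vec p" "y \<noteq> 0\<^sub>v p" for y
  proof -
    let ?z = "M\<^sup>T *\<^sub>v y"
    have z: "?z \<in> carrier_vec k" using Mt y(1) by (rule mult_mat_vec_carrier)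
    have "(M * L * M\<^sup>T) *\<^sub>v y = M *\<^sub>v (L *\<^sub>v ?z)"
      using assoc_mult_mat_vec[OF MH Mt y(1)] assoc_mult_mat_vec[OF M Lc z] by simp
    then have "y \<bullet> ((M * L * M\<^sup>T) *\<^sub>v y) = ?z \<bullet> (L *\<^sub>v ?z)"
      using transpose_vec_mult_scalar[OF M mult_mat_vec_carrier[OF Lc z] y(1)] by simp
    moreover have "?z \<noteq> 0\<^sub>v k" using ker y by blast
    ultimately show ?thesis using L z by (simp add: pos_def_def)
  qed
  then show ?thesis using MH Mt sym by (simp add: pos_def_def)
qed

text \<open>The columns span the whole space, so \<open>y = M z\<close> for some \<open>z\<close>, and then
  \<open>y \<bullet> y = (M\<^sup>T y) \<bullet> z = 0\<close>.\<close>

lemma full_row_rank_left_kernel: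
  assumes M: "M \<in> carrier_mat p k" and rank: "full_row_rank M"
    and y: "y \<in> carrier_vec p" and ker: "M\<^sup>T *\<^sub>v y = 0\<^sub>v k"
  shows "y = 0\<^sub>v p"
proof -
  interpret V: vec_space "TYPE(real)" p .
  have rk: "V.rank M = p" using rank M by (simp add: full_row_rank_def)
  have cols: "set (cols M) \<subseteq> carrier_vec p" using cols_dim[of M] M by simp
  obtain B where B: "maximal B (\<lambda>T. T \<subseteq> set (cols M) \<and> V.lin_indpt T)"
    using maximal_exists_superset[of "set (cols M)" "\<lambda>T. T \<subseteq> set (cols M) \<and> V.lin_indpt T" "{}"]
    by (auto simp: V.lin_dep_def)
  then have Bc: "B \<subseteq> set (cols M)" and Bl: "V.lin_indpt B" by (auto simp: maximal_def)
  \<comment> \<open>The rank is the size of a maximal independent set of columns, so here such a set is a basis.\<close>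
  have "card B = p" using V.rank_card_indpt[OF M B] rk by simp
  then have "V.basis B"
    using Bc Bl cols finite_subset[OF Bc] by (intro V.dim_li_is_basis) (auto simp: V.dim_is_n)
  then have "V.span B = carrier_vec p" by (simp add: V.basis_def)
  then have "y \<in> V.span (set (cols M))" using y V.span_is_monotone[OF Bc] by auto
  then have "y \<in> V.col_space M" by (simp add: V.col_space_def)
  then obtain z where z: "z \<in> carrier_vec k" "M *\<^sub>v z = y"
    using V.col_space_eq[OF M] M by auto
  have "y \<bullet> y = (M\<^sup>T *\<^sub>v y) \<bullet> z" using transpose_vec_mult_scalar[OF M z(1) y] z(2) by simp
  then have "y \<bullet> y = 0" using ker z(1) by simp
  then have "(\<Sum>i<p. y $ i * y $ i) = 0" using y by (simp add: scalar_prod_def atLeast0LessThan)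
  then have "\<forall>i<p. y $ i = 0" by (subst (asm) sum_nonneg_eq_0_iff) auto
  then show ?thesis using y by (intro eq_vecI) auto
qed

lemma inv_mat_solves_shifted:
  fixes M :: "real mat"
  assumes inv: "invertible_mat M" and M: "M \<in> carrier_mat k k"
    and v: "v \<in> carrier_vec k" and E: "E \<in> carrier_mat k l" and x: "x \<in> carrier_vec l"
    and w: "w \<in> carrier_vec k" and eq: "M *\<^sub>v v = w + E *\<^sub>v x"
  shows "v = (inv_mat M * E) *\<^sub>v x + inv_mat M *\<^sub>v w"
proof -
  note Mi = inv_mat_inverse[OF M invertible_mat_det_nonzero[OF inv]]
  have Ex: "E *\<^sub>v x \<in> carrier_vec k" using E x by (rule mult_mat_vec_carrier)
  have "v = inv_mat M *\<^sub>v (M *\<^sub>v v)"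
    using v by (simp add: assoc_mult_mat_vec[OF Mi(1) M v, symmetric] Mi(3))
  also have "\<dots> = inv_mat M *\<^sub>v w + inv_mat M *\<^sub>v (E *\<^sub>v x)"
    unfolding eq by (rule mult_add_distrib_mat_vec[OF Mi(1) w Ex])
  also have "\<dots> = inv_mat M *\<^sub>v (E *\<^sub>v x) + inv_mat M *\<^sub>v w"
    using mult_mat_vec_carrier[OF Mi(1) w] mult_mat_vec_carrier[OF Mi(1) Ex] by (rule comm_add_vec)
  finally show ?thesis unfolding assoc_mult_mat_vec[OF Mi(1) E x] .
qed

section \<open>Selecting rows\<close>

lemma pick_lessThan: "i < l \<Longrightarrow> pick {..<l} i = i"
proof -
  assume i: "i < l"
  then have "{a \<in> {..<l}. a < i} = {..<i}" by auto
  then show ?thesis using pick_card_in_set[of i "{..<l}"] i by simp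
qed

lemma bij_betw_pick:
  assumes "finite I"
  shows "bij_betw (pick I) {..<card I} I"
proof (rule bij_betw_byWitness[where f' = "\<lambda>a. card {b \<in> I. b < a}"])
  show "\<forall>i\<in>{..<card I}. card {b \<in> I. b < pick I i} = i" by (simp add: card_pick_le)
  show "\<forall>a\<in>I. pick I (card {b \<in> I. b < a}) = a" by (simp add: pick_card_in_set)
  show "pick I ` {..<card I} \<subseteq> I" by (auto intro: pick_in_set_le)
  show "(\<lambda>a. card {b \<in> I. b < a}) ` I \<subseteq> {..<card I}"
    using assms by (auto intro!: psubset_card_mono)
qed

context
  fixes I :: "nat set" and p :: nat
  assumes I: "I \<subseteq> {..<p}"
begin

lemma selected_rows: "{i. i < p \<and> i \<in> I} = I"
  using I by auto

lemma ball_pick: "(\<forall>i<card I. P (pick I i)) \<longleftrightarrow> (\<forall>a\<in>I. P a)"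
  using bij_betw_imp_surj_on[OF bij_betw_pick[OF finite_subset[OF I finite_lessThan]]] by force

lemma pick_less: "i < card I \<Longrightarrow> pick I i < p"
  using pick_in_set_le[of i I] I by auto

lemma mat_rows_carrier: "M \<in> carrier_mat p k \<Longrightarrow> mat_rows M I \<in> carrier_mat (card I) k"
  by (intro carrier_matI) (simp_all add: dim_submatrix selected_rows)

lemma vec_rows_carrier: "v \<in> carrier_vec p \<Longrightarrow> vec_rows v I \<in> carrier_vec (card I)"
  by (intro carrier_vecI) (simp add: vec_rows_def selected_rows)

lemma vec_rows_index: "v \<in> carrier_vec p \<Longrightarrow> i < card I \<Longrightarrow> vec_rows v I $ i = v $ pick I i"
  by (simp add: vec_rows_def selected_rows)

lemma row_mat_rows:
  "M \<in> carrier_mat p k \<Longrightarrow> i < card I \<Longrightarrow> row (mat_rows M I) i = row M (pick I i)"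
  using pick_less[of i]
  by (intro eq_vecI) (simp_all add: submatrix_def selected_rows pick_UNIV)

lemma mat_rows_mult_vec:
  assumes "M \<in> carrier_mat p k"
  shows "mat_rows M I *\<^sub>v v = vec_rows (M *\<^sub>v v) I"
proof -
  have "M *\<^sub>v v \<in> carrier_vec p" using assms by (intro carrier_vecI) simp
  then show ?thesis
    using assms mat_rows_carrier[OF assms] pick_less
    by (intro eq_vecI) (simp_all add: vec_rows_def selected_rows row_mat_rows)
qed

lemma mat_rows_mult:
  assumes M: "M \<in> carrier_mat p k" and N: "N \<in> carrier_mat k l"
  shows "mat_rows (M * N) I = mat_rows M I * N"
proof (rule eq_matI)
  have c: "mat_rows (M * N) I \<in> carrier_mat (card I) l" "mat_rows M I \<in> carrier_mat (card I) k"
    using mat_rows_carrier mult_carrier_mat[OF M N] M by auto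
  then show "dim_row (mat_rows (M * N) I) = dim_row (mat_rows M I * N)"
    "dim_col (mat_rows (M * N) I) = dim_col (mat_rows M I * N)" using N by auto
  fix i j assume "i < dim_row (mat_rows M I * N)" "j < dim_col (mat_rows M I * N)"
  then have ij: "i < card I" "j < l" using c N by auto
  then have "mat_rows (M * N) I $$ (i, j) = (M * N) $$ (pick I i, j)"
    using M N by (simp add: submatrix_def selected_rows pick_UNIV)
  then show "mat_rows (M * N) I $$ (i, j) = (mat_rows M I * N) $$ (i, j)"
    using ij M N c pick_less by (simp add: row_mat_rows)
qed

lemma vec_rows_add:
  assumes "v \<in> carrier_vec p" "w \<in> carrier_vec p"
  shows "vec_rows (v + w) I = vec_rows v I + vec_rows w I"
  using assms pick_less by (intro eq_vecI) (simp_all add: vec_rows_def selected_rows)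

lemma vec_rows_le_iff:
  assumes "v \<in> carrier_vec p" "w \<in> carrier_vec p"
  shows "vec_rows v I \<le> vec_rows w I \<longleftrightarrow> (\<forall>a\<in>I. v $ a \<le> w $ a)"
  unfolding ball_pick[symmetric]
  using assms by (auto simp: less_eq_vec_def vec_rows_def selected_rows)

lemma vec_rows_eq_iff:
  assumes "v \<in> carrier_vec p" "w \<in> carrier_vec p"
  shows "vec_rows v I = vec_rows w I \<longleftrightarrow> (\<forall>a\<in>I. v $ a = w $ a)"
  unfolding ball_pick[symmetric]
  using assms by (auto simp: vec_eq_iff vec_rows_def selected_rows)

text \<open>Rewriting the sum over positions as a sum over the index set itself makes it possible to compare
  the row combinations of two different index sets.\<close>

lemma mat_rows_transpose_mult_index:
  assumes M: "M \<in> carrier_mat p k" and y: "y \<in> carrier_vec (card I)" and j: "j < k"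
  shows "((mat_rows M I)\<^sup>T *\<^sub>v y) $ j = (\<Sum>a\<in>I. M $$ (a, j) * y $ card {b \<in> I. b < a})"
proof -
  have "((mat_rows M I)\<^sup>T *\<^sub>v y) $ j = (\<Sum>i<card I. M $$ (pick I i, j) * y $ i)"
    using M y j by (simp add: submatrix_def selected_rows pick_UNIV scalar_prod_def atLeast0LessThan)
  also have "\<dots> = (\<Sum>i<card I. M $$ (pick I i, j) * y $ card {b \<in> I. b < pick I i})"
    by (simp add: card_pick_le)
  also have "\<dots> = (\<Sum>a\<in>I. M $$ (a, j) * y $ card {b \<in> I. b < a})"
    by (rule sum.reindex_bij_betw[OF bij_betw_pick]) (rule finite_subset[OF I finite_lessThan])
  finally show ?thesis .
qed

end

text \<open>Linear independence of rows passes to a subset of them: a vanishing combination \<open>y\<close> of the rows in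
  \<open>I\<close> is padded with zeros to a combination \<open>z\<close> of the rows in \<open>J\<close>. The padding has to translate
  between positions in the two enumerations, the position of \<open>a\<close> in \<open>I\<close> being
  \<open>card {b \<in> I. b < a}\<close>.\<close>

lemma left_kernel_mat_rows_subset:
  assumes M: "M \<in> carrier_mat p k" and J: "J \<subseteq> {..<p}" and IJ: "I \<subseteq> J"
    and ker: "\<And>z. z \<in> carrier_vec (card J) \<Longrightarrow> (mat_rows M J)\<^sup>T *\<^sub>v z = 0\<^sub>v k \<Longrightarrow> z = 0\<^sub>v (card J)"
    and y: "y \<in> carrier_vec (card I)" and y0: "(mat_rows M I)\<^sup>T *\<^sub>v y = 0\<^sub>v k"
  shows "y = 0\<^sub>v (card I)"
proof -
  have I: "I \<subseteq> {..<p}" using IJ J by simp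
  have fin: "finite J" using J finite_subset by blast
  define z where "z = vec (card J) (\<lambda>i. if pick J i \<in> I then y $ card {b \<in> I. b < pick J i} else 0)"
  have z: "z \<in> carrier_vec (card J)" by (simp add: z_def)
  have less: "card {b \<in> J. b < a} < card J" if "a \<in> J" for a
    using that fin by (auto intro!: psubset_card_mono)
  have z_at: "z $ card {b \<in> J. b < a} = (if a \<in> I then y $ card {b \<in> I. b < a} else 0)" if "a \<in> J" for a
    using less[OF that] that by (simp add: z_def pick_card_in_set)
  have "((mat_rows M J)\<^sup>T *\<^sub>v z) $ j = 0" if j: "j < k" for j
  proof -
    have "((mat_rows M J)\<^sup>T *\<^sub>v z) $ j =
        (\<Sum>a\<in>J. if a \<in> I then M $$ (a, j) * y $ card {b \<in> I. b < a} else 0)"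
      unfolding mat_rows_transpose_mult_index[OF J M z j] by (intro sum.cong) (simp_all add: z_at)
    also have "\<dots> = (\<Sum>a\<in>I. M $$ (a, j) * y $ card {b \<in> I. b < a})"
      by (simp only: sum.inter_restrict[OF fin, symmetric] inf.absorb2[OF IJ])
    also have "\<dots> = ((mat_rows M I)\<^sup>T *\<^sub>v y) $ j"
      by (rule mat_rows_transpose_mult_index[OF I M y j, symmetric])
    finally show ?thesis using y0 j by simp
  qed
  then have "(mat_rows M J)\<^sup>T *\<^sub>v z = 0\<^sub>v k"
    using carrier_matD[OF mat_rows_carrier[OF J M]] by (intro eq_vecI) auto
  then have z0: "z = 0\<^sub>v (card J)" by (rule ker[OF z])
  have "y $ i = 0" if i: "i < card I" for i
  proof -
    have a: "pick I i \<in> I" using i by (rule pick_in_set_le)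
    then have "y $ card {b \<in> I. b < pick I i} = z $ card {b \<in> J. b < pick I i}"
      using z_at IJ by auto
    moreover have "\<dots> = 0" using z0 less[of "pick I i"] a IJ by auto
    ultimately show ?thesis using i by (simp add: card_pick_le)
  qed
  then show ?thesis using y by (intro eq_vecI) auto
qed

section \<open>Karush-Kuhn-Tucker points of a quadratic program\<close>

text \<open>Write \<open>V = U + d\<close>. The cost difference is \<open>\<nabla>f(U) \<bullet> d\<close> plus half the quadratic form at \<open>d\<close>, and
  stationarity gives \<open>\<nabla>f(U) \<bullet> d = - \<mu> \<bullet> (M d)\<close>, which is nonnegative because
  \<open>\<mu> \<ge> 0\<close> and \<open>M d \<le> 0\<close>. The quadratic gap is kept in the conclusion since it is what
  makes the minimizer unique.\<close>

lemma convex_quadratic_kkt: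
  fixes U V c \<mu> :: "real vec"
  assumes H: "pos_def k H" and c: "c \<in> carrier_vec k" and M: "M \<in> carrier_mat p k"
    and U: "U \<in> carrier_vec k" and V: "V \<in> carrier_vec k" and \<mu>: "\<mu> \<in> carrier_vec p"
    and stationary: "H *\<^sub>v U + c + M\<^sup>T *\<^sub>v \<mu> = 0\<^sub>v k"
    and nonneg: "0\<^sub>v p \<le> \<mu>" and le: "M *\<^sub>v V \<le> M *\<^sub>v U"
  shows "1/2 * (U \<bullet> (H *\<^sub>v U)) + c \<bullet> U + 1/2 * ((V - U) \<bullet> (H *\<^sub>v (V - U)))
    \<le> 1/2 * (V \<bullet> (H *\<^sub>v V)) + c \<bullet> V"
proof -
  define d where "d = V - U"
  have Hc: "H \<in> carrier_mat k k" and Ht: "H\<^sup>T = H" using H by (auto simp: pos_def_def)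
  have d: "d \<in> carrier_vec k" using U V by (simp add: d_def)
  have Vd: "V = U + d" using U V by (auto simp: d_def)
  note carriers = U d c \<mu> mult_mat_vec_carrier[OF Hc U] mult_mat_vec_carrier[OF Hc d]
    mult_mat_vec_carrier[OF M d] mult_mat_vec_carrier[OF M U]
    mult_mat_vec_carrier[OF transpose_carrier_mat[THEN iffD2, OF M] \<mu>]
  have sym: "U \<bullet> (H *\<^sub>v d) = (H *\<^sub>v U) \<bullet> d"
    using transpose_vec_mult_scalar[OF Hc d U] Ht by simp
  have quad: "V \<bullet> (H *\<^sub>v V) = U \<bullet> (H *\<^sub>v U) + 2 * ((H *\<^sub>v U) \<bullet> d) + d \<bullet> (H *\<^sub>v d)"
    unfolding Vd mult_add_distrib_mat_vec[OF Hc U d]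
    using carriers sym comm_scalar_prod[OF d mult_mat_vec_carrier[OF Hc U]]
    by (simp add: add_scalar_prod_distrib[of _ k] scalar_prod_add_distrib[of _ k])
  have lin: "c \<bullet> V = c \<bullet> U + c \<bullet> d"
    unfolding Vd by (rule scalar_prod_add_distrib[OF c U d])
  have "(H *\<^sub>v U + c + M\<^sup>T *\<^sub>v \<mu>) \<bullet> d = 0" using stationary d by simp
  then have grad: "(H *\<^sub>v U) \<bullet> d + c \<bullet> d + \<mu> \<bullet> (M *\<^sub>v d) = 0"
    using carriers transpose_vec_mult_scalar[OF M d \<mu>]
    by (simp add: add_scalar_prod_distrib[of _ k])
  have "M *\<^sub>v V = M *\<^sub>v U + M *\<^sub>v d" unfolding Vd by (rule mult_add_distrib_mat_vec[OF M U d])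
  then have "\<And>i. i < p \<Longrightarrow> (M *\<^sub>v d) $ i \<le> 0"
    using le carriers carrier_matD[OF M] by (simp add: less_eq_vec_def del: index_mult_mat_vec)
  moreover have "\<And>i. i < p \<Longrightarrow> 0 \<le> \<mu> $ i"
    using nonneg \<mu> by (simp add: less_eq_vec_def)
  ultimately have "\<mu> \<bullet> (M *\<^sub>v d) \<le> 0"
    using carrier_matD[OF M] unfolding scalar_prod_def dim_mult_mat_vec
    by (intro sum_nonpos mult_nonneg_nonpos) auto
  then show ?thesis unfolding d_def[symmetric] quad lin using grad by (simp add: algebra_simps)
qed

text \<open>The stationarity equation forces \<open>U = - H\<^sup>-\<^sup>1 (g + M\<^sup>T \<mu>)\<close>. Substituting this into \<open>M U = a\<close>
  yields a linear equation for \<open>\<mu>\<close> with the matrix \<open>M H\<^sup>-\<^sup>1 M\<^sup>T\<close>, whose solution is the \<open>\<mu>\<close> below.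
  The two inequalities assumed on \<open>s\<close> then say precisely that \<open>\<mu>\<close> is dual feasible and that
  \<open>U\<close> respects the remaining constraints \<open>N U \<le> b\<close>.\<close>

lemma parametric_kkt_point:
  fixes g a b :: "real vec"
  assumes H: "H \<in> carrier_mat k k" and Hi: "Hi \<in> carrier_mat k k" and inv: "H * Hi = 1\<^sub>m k"
    and M: "M \<in> carrier_mat p k" and N: "N \<in> carrier_mat r k"
    and W: "W \<in> carrier_mat p p" and Winv: "(M * Hi * M\<^sup>T) * W = 1\<^sub>m p"
    and g: "g \<in> carrier_vec k" and a: "a \<in> carrier_vec p" and b: "b \<in> carrier_vec r"
  defines "s \<equiv> a + (M * Hi) *\<^sub>v g"
  defines "\<mu> \<equiv> - (W *\<^sub>v s)"
  defines "U \<equiv> - (Hi *\<^sub>v (g + M\<^sup>T *\<^sub>v \<mu>))"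
  assumes dual: "W *\<^sub>v s \<le> 0\<^sub>v p"
    and primal: "(N * Hi * M\<^sup>T * W) *\<^sub>v s \<le> b + (N * Hi) *\<^sub>v g"
  shows "U \<in> carrier_vec k" "\<mu> \<in> carrier_vec p" "0\<^sub>v p \<le> \<mu>"
    "H *\<^sub>v U + g + M\<^sup>T *\<^sub>v \<mu> = 0\<^sub>v k" "M *\<^sub>v U = a" "N *\<^sub>v U \<le> b"
proof -
  have Mt: "M\<^sup>T \<in> carrier_mat k p" using M by simp
  have s: "s \<in> carrier_vec p"
    unfolding s_def using a mult_mat_vec_carrier[OF mult_carrier_mat[OF M Hi] g] by simp
  have Ws: "W *\<^sub>v s \<in> carrier_vec p" using W s by (rule mult_mat_vec_carrier)
  show \<mu>: "\<mu> \<in> carrier_vec p" using Ws by (simp add: \<mu>_def)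
  define t where "t = g + M\<^sup>T *\<^sub>v \<mu>"
  have mtl: "M\<^sup>T *\<^sub>v \<mu> \<in> carrier_vec k" using Mt \<mu> by (rule mult_mat_vec_carrier)
  have t: "t \<in> carrier_vec k" using g mtl by (simp add: t_def)
  have Hit: "Hi *\<^sub>v t \<in> carrier_vec k" using Hi t by (rule mult_mat_vec_carrier)
  have U: "U = - (Hi *\<^sub>v t)" by (simp add: U_def t_def)
  show Uc: "U \<in> carrier_vec k" using Hit by (simp add: U)
  show "0\<^sub>v p \<le> \<mu>" using dual Ws by (auto simp: \<mu>_def less_eq_vec_def simp del: index_mult_mat_vec)
  have neg: "Q *\<^sub>v (- v) = - (Q *\<^sub>v v)" if "Q \<in> carrier_mat l h" "v \<in> carrier_vec h" for Q :: "real mat" and v l h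
    using that by (intro eq_vecI) auto
  have "H *\<^sub>v U = - t"
    unfolding U neg[OF H Hit] assoc_mult_mat_vec[OF H Hi t, symmetric] inv using t by simp
  then have "H *\<^sub>v U + (g + M\<^sup>T *\<^sub>v \<mu>) = 0\<^sub>v k" using t unfolding t_def[symmetric] by simp
  then show "H *\<^sub>v U + g + M\<^sup>T *\<^sub>v \<mu> = 0\<^sub>v k"
    using assoc_add_vec[OF mult_mat_vec_carrier[OF H Uc] g mtl] by simp
  have rows_U: "Q *\<^sub>v U = (Q * Hi * M\<^sup>T * W) *\<^sub>v s - (Q * Hi) *\<^sub>v g" if Q: "Q \<in> carrier_mat l k" for Q l
  proof -
    have QHi: "Q * Hi \<in> carrier_mat l k" using Q Hi by simp
    have QM: "Q * Hi * M\<^sup>T \<in> carrier_mat l p" using QHi Mt by simp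
    have e1: "(Q * Hi) *\<^sub>v (M\<^sup>T *\<^sub>v \<mu>) = - ((Q * Hi * M\<^sup>T * W) *\<^sub>v s)"
      unfolding assoc_mult_mat_vec[OF QHi Mt \<mu>, symmetric]
      unfolding \<mu>_def neg[OF QM Ws] assoc_mult_mat_vec[OF QM W s, symmetric] ..
    have "Q *\<^sub>v U = - ((Q * Hi) *\<^sub>v t)"
      unfolding U neg[OF Q Hit] assoc_mult_mat_vec[OF Q Hi t, symmetric] ..
    also have "(Q * Hi) *\<^sub>v t = (Q * Hi) *\<^sub>v g + - ((Q * Hi * M\<^sup>T * W) *\<^sub>v s)"
      unfolding t_def mult_add_distrib_mat_vec[OF QHi g mtl] e1 ..
    also have "- \<dots> = (Q * Hi * M\<^sup>T * W) *\<^sub>v s - (Q * Hi) *\<^sub>v g"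
      using mult_mat_vec_carrier[OF QHi g] mult_mat_vec_carrier[OF mult_carrier_mat[OF QM W] s]
      by (intro eq_vecI) (auto simp del: index_mult_mat_vec)
    finally show ?thesis .
  qed
  show "M *\<^sub>v U = a"
    unfolding rows_U[OF M] Winv
    using s a mult_mat_vec_carrier[OF mult_carrier_mat[OF M Hi] g] carrier_matD[OF M] unfolding s_def
    by (intro eq_vecI) (auto simp del: index_mult_mat_vec)
  show "N *\<^sub>v U \<le> b"
    unfolding rows_U[OF N]
    using primal b mult_mat_vec_carrier[OF mult_carrier_mat[OF N Hi] g] carrier_matD[OF N]
    by (auto simp: less_eq_vec_def algebra_simps simp del: index_mult_mat_vec)
qed

text \<open>The next two lemmas read the two blocks of inequalities of a critical polytope as conditions on
  \<open>W s\<close> and \<open>G\<^sub>\<I> H\<^sup>-\<^sup>1 G\<^sub>\<A>\<^sup>T W s\<close> with \<open>s = w\<^sub>\<A> + S\<^sub>\<A> x\<close>.\<close>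

lemma vec_le_uminus:
  fixes v w :: "real vec"
  assumes "v \<in> carrier_vec l" "w \<in> carrier_vec l" "v \<le> - w"
  shows "w + v \<le> 0\<^sub>v l"
  using assms by (force simp: less_eq_vec_def)

lemma vec_le_uminus_minus:
  fixes a b c d :: "real vec"
  assumes "a \<in> carrier_vec l" "b \<in> carrier_vec l" "c \<in> carrier_vec l" "d \<in> carrier_vec l"
    and "b - d \<le> - (a - c)"
  shows "a + b \<le> c + d"
  using assms by (force simp: less_eq_vec_def algebra_simps)

section \<open>Positive definiteness of the Hessian\<close>

context mpc_assumptions
begin

lemma qp_carriers:
  shows qpG_carrier: "qpG S \<in> carrier_mat (dim_row (qpG S)) (m * N)"
    and qpw_carrier: "qpw S \<in> carrier_vec (dim_row (qpG S))"
    and qpE_carrier: "qpE S \<in> carrier_mat (dim_row (qpG S)) n"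
proof -
  have "set [0..<N] \<subseteq> {..<N}" by auto
  from stacked_constraints[OF zero_carrier_vec zero_carrier_vec this]
  show "qpG S \<in> carrier_mat (dim_row (qpG S)) (m * N)"
    "qpw S \<in> carrier_vec (dim_row (qpG S))" "qpE S \<in> carrier_mat (dim_row (qpG S)) n"
    unfolding qpG_def[symmetric] qpw_def[symmetric] qpE_def[symmetric] by blast+
qed

lemma qpH_carrier: "qpH S \<in> carrier_mat (m * N) (m * N)"
  by (simp add: qpH_def Let_def)

lemma qpF_carrier: "qpF S \<in> carrier_mat n (m * N)"
  by (simp add: qpF_def Let_def)

lemma qpH_symmetric: "(qpH S)\<^sup>T = qpH S"
proof (rule eq_matI)
  have sym: "(L\<^sup>T * M * L) $$ (j, i) = (L\<^sup>T * M * L) $$ (i, j)"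
    if L: "L \<in> carrier_mat r (m * N)" and M: "M \<in> carrier_mat r r" "M\<^sup>T = M"
      and ij: "i < m * N" "j < m * N" for L M :: "real mat" and r i j
  proof -
    have Lt: "L\<^sup>T \<in> carrier_mat (m * N) r" using L by simp
    have "(L\<^sup>T * M * L)\<^sup>T = L\<^sup>T * (M * L)"
      using transpose_mult[OF mult_carrier_mat[OF Lt M(1)] L] transpose_mult[OF Lt M(1)] M(2) by simp
    also have "\<dots> = L\<^sup>T * M * L" by (rule assoc_mult_mat[OF Lt M(1) L, symmetric])
    finally have "(L\<^sup>T * M * L) $$ (i, j) = (L\<^sup>T * M * L)\<^sup>T $$ (i, j)" by simp
    then show ?thesis using L M ij by (simp del: index_mult_mat(1))
  qed
  have P: "wtP S \<in> carrier_mat n n" "(wtP S)\<^sup>T = wtP S"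
    and Q: "wtQ S \<in> carrier_mat n n" "(wtQ S)\<^sup>T = wtQ S"
    and R: "wtR S \<in> carrier_mat m m" "(wtR S)\<^sup>T = wtR S"
    using wtQ_psd wtP_pd wtR_pd by (auto simp: pos_semidef_def pos_def_def)
  fix i j assume "i < dim_row (qpH S)" "j < dim_col (qpH S)"
  then have ij: "i < m * N" "j < m * N" using carrier_matD[OF qpH_carrier] by simp_all
  then show "(qpH S)\<^sup>T $$ (i, j) = qpH S $$ (i, j)"
    unfolding qpH_def Let_def
    by (simp add: sym[OF pred_mat_carrier P] sym[OF pred_mat_carrier Q] sym[OF input_mat_carrier R]
        del: index_mult_mat)
qed (use qpH_carrier in auto)

lemma input_mat_mult_index:
  assumes k: "k < N" and i: "i < m" and U: "U \<in> carrier_vec (m * N)"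
  shows "(input_mat S k *\<^sub>v U) $ i = U $ (k * m + i)"
proof -
  have "k * m + i < Suc k * m" using i by simp
  also have "\<dots> \<le> N * m" using k by (intro mult_le_mono1) simp
  finally have lt: "k * m + i < m * N" by (simp add: mult.commute)
  have "(input_mat S k *\<^sub>v U) $ i = (\<Sum>c<m * N. (if c = k * m + i then 1 else 0) * U $ c)"
    using i U by (auto simp: input_mat_def scalar_prod_def atLeast0LessThan intro!: sum.cong)
  also have "\<dots> = (\<Sum>c<m * N. if c = k * m + i then U $ c else 0)"
    by (intro sum.cong) auto
  also have "\<dots> = U $ (k * m + i)" using lt by simp
  finally show ?thesis .
qed

text \<open>At the initial state zero the cost of the QP is half the quadratic form of \<open>H\<close>. It equals the cost
  of the control problem, to which every nonzero input contributes a positive term through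
  \<open>R\<close>.\<close>

lemma qpH_pos_def: "pos_def (m * N) (qpH S)"
proof -
  have "0 < U \<bullet> (qpH S *\<^sub>v U)" if U: "U \<in> carrier_vec (m * N)" "U \<noteq> 0\<^sub>v (m * N)" for U
  proof -
    have zero: "0\<^sub>v n \<in> carrier_vec n" by simp
    have "qpF S *\<^sub>v U \<in> carrier_vec n" using qpF_carrier U(1) by (rule mult_mat_vec_carrier)
    moreover have "qpY S *\<^sub>v 0\<^sub>v n \<in> carrier_vec n"
      by (intro carrier_vecI) (simp add: qpY_def Let_def)
    ultimately have cost: "U \<bullet> (qpH S *\<^sub>v U) = 2 * ocp_cost S (0\<^sub>v n) U"
      using qp_cost_eq[OF zero U(1)] by (simp add: qp_cost_def)
    have st: "state S (0\<^sub>v n) U k \<in> carrier_vec n" if "k \<le> N" for k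
      unfolding state_eq[OF zero U(1) that]
      using mult_mat_vec_carrier[OF power_carrier zero] mult_mat_vec_carrier[OF pred_mat_carrier U(1)]
      by (intro add_carrier_vec)
    have inp: "input_mat S k *\<^sub>v U \<in> carrier_vec m" for k
      using input_mat_carrier U(1) by (rule mult_mat_vec_carrier)
    have psd: "0 \<le> v \<bullet> (M *\<^sub>v v)" if "pos_def l M" "v \<in> carrier_vec l" for l M v
      using that unfolding pos_def_def by (cases "v = 0\<^sub>v l") (auto intro: less_imp_le)
    have P: "0 \<le> state S (0\<^sub>v n) U N \<bullet> (wtP S *\<^sub>v state S (0\<^sub>v n) U N)"
      using psd[OF wtP_pd st] by simp
    have Q: "0 \<le> state S (0\<^sub>v n) U k \<bullet> (wtQ S *\<^sub>v state S (0\<^sub>v n) U k)" if "k < N" for k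
      using wtQ_psd st[of k] that by (simp add: pos_semidef_def)
    have R: "0 \<le> (input_mat S k *\<^sub>v U) \<bullet> (wtR S *\<^sub>v (input_mat S k *\<^sub>v U))" for k
      using psd[OF wtR_pd inp] .
    \<comment> \<open>A nonzero entry of \<open>U\<close> belongs to one of the inputs \<open>u(k)\<close>, which is then nonzero.\<close>
    obtain c where c: "c < m * N" "U $ c \<noteq> 0"
      using U by (metis carrier_vecD eq_vecI index_zero_vec)
    define k where "k = c div m"
    have k: "k < N" using c(1) by (simp add: k_def less_mult_imp_div_less mult.commute)
    have "0 < m" using c(1) by (cases m) auto
    then have "(input_mat S k *\<^sub>v U) $ (c mod m) = U $ c"
      using input_mat_mult_index[OF k _ U(1), of "c mod m"] by (simp add: k_def)
    then have "input_mat S k *\<^sub>v U \<noteq> 0\<^sub>v m" using c(2) \<open>0 < m\<close> by auto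
    then have Rk: "0 < (input_mat S k *\<^sub>v U) \<bullet> (wtR S *\<^sub>v (input_mat S k *\<^sub>v U))"
      using wtR_pd inp by (simp add: pos_def_def)
    have "0 < (\<Sum>k<N. state S (0\<^sub>v n) U k \<bullet> (wtQ S *\<^sub>v state S (0\<^sub>v n) U k) +
          (input_mat S k *\<^sub>v U) \<bullet> (wtR S *\<^sub>v (input_mat S k *\<^sub>v U)))"
      by (rule sum_pos2[of _ k]) (use k Q R Rk in \<open>auto intro: add_nonneg_pos add_nonneg_nonneg\<close>)
    then show ?thesis unfolding cost ocp_cost_def Let_def using P by simp
  qed
  then show ?thesis using qpH_carrier qpH_symmetric by (simp add: pos_def_def)
qed

section \<open>Constraints of stage 0\<close>

text \<open>Isolates the constraints of stage 0, whose rows make up \<open>G\<^sup>1\<^sup>1\<close>.\<close>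

lemma qpG_split:
  obtains R where "R \<in> carrier_mat (dim_row R) (m * N)"
    "qpG S = (matU S * input_mat S 0) @\<^sub>r (matX S * pred_mat S 1) @\<^sub>r R"
proof -
  define R where "R = foldr (\<lambda>k M. (matU S * input_mat S k) @\<^sub>r (stage_mat S k * pred_mat S (Suc k)) @\<^sub>r M)
     [1..<N] (0\<^sub>m (dim_row (matX S)) (m * N))"
  have "set [1..<N] \<subseteq> {..<N}" by auto
  from stacked_constraints[OF zero_carrier_vec zero_carrier_vec this]
  have "R \<in> carrier_mat (dim_row R) (m * N)" unfolding R_def by blast
  moreover have "[0..<N] = 0 # [1..<N]" using horizon_ge_2 by (simp add: upt_conv_Cons)
  then have "qpG S = (matU S * input_mat S 0) @\<^sub>r (matX S * pred_mat S 1) @\<^sub>r R"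
    using horizon_ge_2 unfolding qpG_def R_def by (simp add: stage_mat_def)
  ultimately show ?thesis by (rule that)
qed

lemma stage0_constraints_subset: "stage0_constraints S \<subseteq> constraints S"
proof -
  obtain R where "qpG S = (matU S * input_mat S 0) @\<^sub>r (matX S * pred_mat S 1) @\<^sub>r R"
    using qpG_split .
  then show ?thesis by (auto simp: stage0_constraints_def constraints_def append_rows_def)
qed

text \<open>The inputs after \<open>u(0)\<close> do not enter the constraints on \<open>u(0)\<close> and \<open>x(1)\<close>. A horizon of at
  least 2 is what places \<open>x(1) \<in> \<X>\<close>, rather than the terminal constraint, among these rows.\<close>

lemma stage0_row_zero:
  assumes i: "i \<in> stage0_constraints S" and c: "c < m * N" "m \<le> c"
  shows "qpG S $$ (i, c) = 0"
proof -
  obtain R where R: "R \<in> carrier_mat (dim_row R) (m * N)"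
    and G: "qpG S = (matU S * input_mat S 0) @\<^sub>r (matX S * pred_mat S 1) @\<^sub>r R"
    using qpG_split .
  let ?u = "dim_row (matU S)" and ?x = "dim_row (matX S)"
  have "0 < m" using c(1) by (cases m) auto
  then have "0 < c div m" using c(2) by (simp add: div_greater_zero_iff)
  then have "col (input_mat S 0) c = 0\<^sub>v m" "col (pred_mat S 1) c = 0\<^sub>v n"
    using c by (auto simp: input_mat_def pred_mat_def Let_def intro!: eq_vecI)
  then have U: "j < ?u \<Longrightarrow> (matU S * input_mat S 0) $$ (j, c) = 0"
    and X: "j < ?x \<Longrightarrow> (matX S * pred_mat S 1) $$ (j, c) = 0" for j
    using c(1) carrier_matD[OF halfspace_carriers(1)] carrier_matD[OF halfspace_carriers(3)]
      carrier_matD[OF input_mat_carrier[of 0]] carrier_matD[OF pred_mat_carrier[of 1]]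
    by (auto intro!: scalar_prod_right_zero carrier_vecI)
  show ?thesis
    unfolding G append_rows_def using i c(1) U X carrier_matD[OF R]
      carrier_matD[OF input_mat_carrier[of 0]] carrier_matD[OF pred_mat_carrier[of 1]]
    by (auto simp: stage0_constraints_def simp del: index_mult_mat(1))
qed

lemma G11_carrier: "G11 S \<in> carrier_mat (dim_row (matU S) + dim_row (matX S)) m"
proof -
  have "{i. i < dim_row (qpG S) \<and> i \<in> stage0_constraints S} = stage0_constraints S"
    using stage0_constraints_subset by (auto simp: constraints_def)
  moreover have "m \<le> m * N" using horizon_ge_2 by (cases N) auto
  from less_le_trans[OF _ this] have "{j. j < m * N \<and> j < m} = {..<m}" by blast
  ultimately show ?thesis
    using carrier_matD[OF qpG_carrier]
    by (intro carrier_matI) (simp_all add: G11_def dim_submatrix, simp add: stage0_constraints_def)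
qed

text \<open>The columns of \<open>G\<close> that \<open>G\<^sup>1\<^sup>1\<close> cuts off vanish in these rows.\<close>

lemma stage0_rows_mult:
  assumes i: "i \<in> stage0_constraints S" and U: "U \<in> carrier_vec (m * N)"
  shows "(G11 S *\<^sub>v vec_first U m) $ i = (qpG S *\<^sub>v U) $ i"
proof -
  have le: "m \<le> m * N" using horizon_ge_2 by (cases N) auto
  have i_less: "i < dim_row (matU S) + dim_row (matX S)" "i < dim_row (qpG S)"
    using i stage0_constraints_subset by (auto simp: stage0_constraints_def constraints_def)
  have entry: "G11 S $$ (i, j) = qpG S $$ (i, j)" if "j < m" for j
  proof -
    have "G11 S $$ (i, j) = qpG S $$ (pick (stage0_constraints S) i, pick {..<m} j)"
      using carrier_matD[OF G11_carrier] i_less(1) that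
      unfolding G11_def dim_submatrix by (intro submatrix_index) simp_all
    then show ?thesis using that i_less(1) by (simp add: stage0_constraints_def pick_lessThan)
  qed
  have "(G11 S *\<^sub>v vec_first U m) $ i = (\<Sum>j<m. qpG S $$ (i, j) * U $ j)"
    using carrier_matD[OF G11_carrier] i_less
    by (simp add: scalar_prod_def vec_first_def atLeast0LessThan entry)
  also have "\<dots> = (\<Sum>j<m * N. qpG S $$ (i, j) * U $ j)"
    using le by (intro sum.mono_neutral_left) (auto simp: stage0_row_zero[OF i])
  also have "\<dots> = (qpG S *\<^sub>v U) $ i"
    using carrier_matD[OF qpG_carrier] i_less U
    by (simp add: scalar_prod_def atLeast0LessThan)
  finally show ?thesis .
qed

section \<open>Optimality on the critical polytopes\<close>

lemma qp_rhs_carrier: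
  "x \<in> carrier_vec n \<Longrightarrow> qpw S + qpE S *\<^sub>v x \<in> carrier_vec (dim_row (qpG S))"
  using qpw_carrier mult_mat_vec_carrier[OF qpE_carrier] by (intro add_carrier_vec) auto

lemma qpS_carrier: "qpS S \<in> carrier_mat (dim_row (qpG S)) n"
  unfolding qpS_def
  by (rule add_carrier_mat, rule mult_carrier_mat, rule mult_carrier_mat[OF qpG_carrier],
      rule inv_mat_inverse(1)[OF qpH_carrier pos_def_det_nonzero[OF qpH_pos_def]])
    (use qpF_carrier in simp)

text \<open>The multipliers are attached to the constraints in \<open>\<A>\<close> only, all of which hold with equality at \<open>U\<close>.
  Hence any feasible \<open>V\<close> satisfies \<open>G\<^sub>\<A> V \<le> G\<^sub>\<A> U\<close>, and the cost gap is positive for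
  \<open>V \<noteq> U\<close>.\<close>

lemma qp_kkt_optimal:
  assumes x: "x \<in> carrier_vec n" and A: "\<A> \<subseteq> constraints S"
    and feasible: "qp_feasible S x U" and \<mu>: "\<mu> \<in> carrier_vec (card \<A>)"
    and stationary: "qpH S *\<^sub>v U + (qpF S)\<^sup>T *\<^sub>v x + (mat_rows (qpG S) \<A>)\<^sup>T *\<^sub>v \<mu> = 0\<^sub>v (m * N)"
    and nonneg: "0\<^sub>v (card \<A>) \<le> \<mu>"
    and active: "\<And>i. i \<in> \<A> \<Longrightarrow> (qpG S *\<^sub>v U) $ i = (qpw S + qpE S *\<^sub>v x) $ i"
  shows "qp_solution S x U" "qp_opt S x = U"
proof -
  let ?Fx = "(qpF S)\<^sup>T *\<^sub>v x"
  have A': "\<A> \<subseteq> {..<dim_row (qpG S)}" using A by (simp add: constraints_def)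
  have Fx: "?Fx \<in> carrier_vec (m * N)"
    using transpose_carrier_mat[THEN iffD2, OF qpF_carrier] x by (rule mult_mat_vec_carrier)
  have U: "U \<in> carrier_vec (m * N)" using feasible by (simp add: qp_feasible_def)
  have cost: "qp_cost S x V =
      1/2 * (V \<bullet> (qpH S *\<^sub>v V)) + ?Fx \<bullet> V + 1/2 * (x \<bullet> (qpY S *\<^sub>v x))"
    if V: "V \<in> carrier_vec (m * N)" for V
    using transpose_vec_mult_scalar[OF qpF_carrier V x] by (simp add: qp_cost_def)
  have gap: "qp_cost S x U + 1/2 * ((V - U) \<bullet> (qpH S *\<^sub>v (V - U))) \<le> qp_cost S x V"
    if V: "qp_feasible S x V" for V
  proof -
    have Vc: "V \<in> carrier_vec (m * N)" using V by (simp add: qp_feasible_def)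
    have "(qpG S *\<^sub>v V) $ i \<le> (qpw S + qpE S *\<^sub>v x) $ i" if "i \<in> \<A>" for i
      using V A' qp_rhs_carrier[OF x] that by (auto simp: qp_feasible_def less_eq_vec_def)
    then have "\<forall>i\<in>\<A>. (qpG S *\<^sub>v V) $ i \<le> (qpG S *\<^sub>v U) $ i" using active by simp
    then have "mat_rows (qpG S) \<A> *\<^sub>v V \<le> mat_rows (qpG S) \<A> *\<^sub>v U"
      unfolding mat_rows_mult_vec[OF A' qpG_carrier]
      using vec_rows_le_iff[OF A' mult_mat_vec_carrier[OF qpG_carrier Vc] mult_mat_vec_carrier[OF qpG_carrier U]]
      by blast
    from convex_quadratic_kkt[OF qpH_pos_def Fx mat_rows_carrier[OF A' qpG_carrier] U Vc \<mu>
        stationary nonneg this]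
    show ?thesis unfolding cost[OF U] cost[OF Vc] by simp
  qed
  have pos: "0 < (V - U) \<bullet> (qpH S *\<^sub>v (V - U))" if "V \<in> carrier_vec (m * N)" "V \<noteq> U" for V
  proof -
    have "V = U" if "V - U = 0\<^sub>v (m * N)"
    proof (rule eq_vecI)
      show "V $ i = U $ i" if "i < dim_vec U" for i
        using arg_cong[OF \<open>V - U = 0\<^sub>v (m * N)\<close>, of "\<lambda>v. v $ i"] that U \<open>V \<in> carrier_vec (m * N)\<close> by simp
    qed (use U \<open>V \<in> carrier_vec (m * N)\<close> in simp)
    then have "V - U \<noteq> 0\<^sub>v (m * N)" using that(2) by blast
    then show ?thesis using minus_carrier_vec[OF that(1) U] qpH_pos_def unfolding pos_def_def by blast
  qed
  have less: "qp_cost S x U < qp_cost S x V" if "qp_feasible S x V" "V \<noteq> U" for V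
    using gap[OF that(1)] pos[OF _ that(2)] that(1) by (simp add: qp_feasible_def)
  show sol: "qp_solution S x U"
    unfolding qp_solution_def
  proof (intro conjI allI impI feasible)
    show "qp_cost S x U \<le> qp_cost S x V" if "qp_feasible S x V" for V
      using less[OF that] by (cases "V = U") simp_all
  qed
  show "qp_opt S x = U"
    unfolding qp_opt_def
  proof (rule the_equality, rule sol, rule ccontr)
    fix V assume "qp_solution S x V" "V \<noteq> U"
    then have "qp_cost S x U < qp_cost S x V" "qp_cost S x V \<le> qp_cost S x U"
      using less feasible by (simp_all add: qp_solution_def)
    then show False by simp
  qed
qed

text \<open>The inequalities defining the polytope are dual feasibility (first block) and primal feasibility
  (second block) of the point from \<open>parametric_kkt_point\<close> at which
  the constraints in \<open>\<A>\<close> hold with equality.\<close>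

lemma critical_polytope_optimal:
  assumes A: "\<A> \<subseteq> constraints S"
    and ker: "\<And>y. y \<in> carrier_vec (card \<A>) \<Longrightarrow>
      (mat_rows (qpG S) \<A>)\<^sup>T *\<^sub>v y = 0\<^sub>v (m * N) \<Longrightarrow> y = 0\<^sub>v (card \<A>)"
    and x: "x \<in> critical_polytope S \<A>"
  shows "x \<in> feasible_states S" "qp_opt S x \<in> carrier_vec (m * N)"
    "\<forall>i\<in>\<A>. (qpG S *\<^sub>v qp_opt S x) $ i = (qpw S + qpE S *\<^sub>v x) $ i"
proof -
  define q where "q = dim_row (qpG S)"
  define I where "I = constraints S - \<A>"
  have Aq: "\<A> \<subseteq> {..<q}" and Iq: "I \<subseteq> {..<q}"
    using A by (auto simp: constraints_def q_def I_def)
  note G = qpG_carrier[folded q_def] and w = qpw_carrier[folded q_def]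
    and E = qpE_carrier[folded q_def] and Sc = qpS_carrier[folded q_def]
  let ?Hi = "inv_mat (qpH S)"
  let ?g = "(qpF S)\<^sup>T *\<^sub>v x"
  let ?GA = "mat_rows (qpG S) \<A>" and ?GI = "mat_rows (qpG S) I"
  let ?W = "inv_mat (?GA * ?Hi * ?GA\<^sup>T)"
  let ?a = "vec_rows (qpw S + qpE S *\<^sub>v x) \<A>" and ?b = "vec_rows (qpw S + qpE S *\<^sub>v x) I"
  note Hi = inv_mat_inverse[OF qpH_carrier pos_def_det_nonzero[OF qpH_pos_def]]
  note GA = mat_rows_carrier[OF Aq G] and GI = mat_rows_carrier[OF Iq G]
  have Schur: "pos_def (card \<A>) (?GA * ?Hi * ?GA\<^sup>T)"
    using pos_def_congruence[OF pos_def_inv_mat[OF qpH_pos_def] GA ker] .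
  then have Schur_carrier: "?GA * ?Hi * ?GA\<^sup>T \<in> carrier_mat (card \<A>) (card \<A>)"
    by (simp add: pos_def_def)
  note W = inv_mat_inverse[OF Schur_carrier pos_def_det_nonzero[OF Schur]]
  have xc: "x \<in> carrier_vec n" using x by (simp add: critical_polytope_def Let_def)
  have Ft: "(qpF S)\<^sup>T \<in> carrier_mat (m * N) n" using qpF_carrier by simp
  have g: "?g \<in> carrier_vec (m * N)" using Ft xc by (rule mult_mat_vec_carrier)
  note rhs = qp_rhs_carrier[OF xc, folded q_def]
  \<comment> \<open>Turns the data \<open>w + S x\<close> of the polytope into the right-hand side \<open>w + E x\<close> of the constraints
    plus \<open>G H\<^sup>-\<^sup>1 F\<^sup>T x\<close>, as needed for the KKT point with \<open>g = F\<^sup>T x\<close>.\<close>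
  have shifted: "vec_rows (qpw S) J + mat_rows (qpS S) J *\<^sub>v x =
      vec_rows (qpw S + qpE S *\<^sub>v x) J + (mat_rows (qpG S) J * ?Hi) *\<^sub>v ?g"
    if J: "J \<subseteq> {..<q}" for J
  proof -
    have GH: "qpG S * ?Hi \<in> carrier_mat q (m * N)" using G Hi(1) by (rule mult_carrier_mat)
    have Ex: "qpE S *\<^sub>v x \<in> carrier_vec q" using E xc by (rule mult_mat_vec_carrier)
    have GHg: "(qpG S * ?Hi) *\<^sub>v ?g \<in> carrier_vec q" using GH g by (rule mult_mat_vec_carrier)
    have "qpS S *\<^sub>v x = qpE S *\<^sub>v x + (qpG S * ?Hi) *\<^sub>v ?g"
      unfolding qpS_def add_mult_distrib_mat_vec[OF E mult_carrier_mat[OF GH Ft] xc]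
        assoc_mult_mat_vec[OF GH Ft xc] ..
    then have "qpw S + qpS S *\<^sub>v x = (qpw S + qpE S *\<^sub>v x) + (qpG S * ?Hi) *\<^sub>v ?g"
      using assoc_add_vec[OF w Ex GHg] by simp
    from arg_cong[OF this, of "\<lambda>v. vec_rows v J"] show ?thesis
      unfolding vec_rows_add[OF J w mult_mat_vec_carrier[OF Sc xc]] vec_rows_add[OF J rhs GHg]
        mat_rows_mult_vec[OF J Sc, symmetric] mat_rows_mult_vec[OF J GH, symmetric]
        mat_rows_mult[OF J G Hi(1)] .
  qed
  define s where "s = vec_rows (qpw S) \<A> + mat_rows (qpS S) \<A> *\<^sub>v x"
  note wA = vec_rows_carrier[OF Aq w] and wI = vec_rows_carrier[OF Iq w]
    and SA = mat_rows_carrier[OF Aq Sc] and SI = mat_rows_carrier[OF Iq Sc]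
  have SAx: "mat_rows (qpS S) \<A> *\<^sub>v x \<in> carrier_vec (card \<A>)" using SA xc by (rule mult_mat_vec_carrier)
  have SIx: "mat_rows (qpS S) I *\<^sub>v x \<in> carrier_vec (card I)" using SI xc by (rule mult_mat_vec_carrier)
  have s: "s \<in> carrier_vec (card \<A>)" using wA SAx by (simp add: s_def)
  let ?L = "?GI * ?Hi * ?GA\<^sup>T * ?W"
  have L: "?L \<in> carrier_mat (card I) (card \<A>)"
    using GI Hi(1) GA W(1) by (meson mult_carrier_mat transpose_carrier_mat)
  have split: "Q *\<^sub>v s = Q *\<^sub>v vec_rows (qpw S) \<A> + (Q * mat_rows (qpS S) \<A>) *\<^sub>v x"
    if Q: "Q \<in> carrier_mat l (card \<A>)" for Q l
    unfolding s_def mult_add_distrib_mat_vec[OF Q wA SAx] assoc_mult_mat_vec[OF Q SA xc] ..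
  have WS: "?W * mat_rows (qpS S) \<A> \<in> carrier_mat (card \<A>) n" using W(1) SA by (rule mult_carrier_mat)
  have LS: "?L * mat_rows (qpS S) \<A> \<in> carrier_mat (card I) n" using L SA by (rule mult_carrier_mat)
  have "((?W * mat_rows (qpS S) \<A>) @\<^sub>r (?L * mat_rows (qpS S) \<A> - mat_rows (qpS S) I)) *\<^sub>v x
    \<le> - ((?W *\<^sub>v vec_rows (qpw S) \<A>) @\<^sub>v (?L *\<^sub>v vec_rows (qpw S) \<A> - vec_rows (qpw S) I))"
    using x by (simp add: critical_polytope_def Let_def I_def)
  also have "- ((?W *\<^sub>v vec_rows (qpw S) \<A>) @\<^sub>v (?L *\<^sub>v vec_rows (qpw S) \<A> - vec_rows (qpw S) I)) =
    (- (?W *\<^sub>v vec_rows (qpw S) \<A>)) @\<^sub>v (- (?L *\<^sub>v vec_rows (qpw S) \<A> - vec_rows (qpw S) I))"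
    by (intro eq_vecI) auto
  finally have ineqs: "(?W * mat_rows (qpS S) \<A>) *\<^sub>v x \<le> - (?W *\<^sub>v vec_rows (qpw S) \<A>)"
    "(?L * mat_rows (qpS S) \<A> - mat_rows (qpS S) I) *\<^sub>v x \<le>
      - (?L *\<^sub>v vec_rows (qpw S) \<A> - vec_rows (qpw S) I)"
    using append_rows_le[OF WS minus_carrier_mat[OF SI] uminus_carrier_vec[THEN iffD2, OF mult_mat_vec_carrier[OF W(1) wA]] xc]
    by blast+
  have dual: "?W *\<^sub>v s \<le> 0\<^sub>v (card \<A>)"
    unfolding split[OF W(1)]
    by (rule vec_le_uminus[OF mult_mat_vec_carrier[OF WS xc] mult_mat_vec_carrier[OF W(1) wA] ineqs(1)])
  have "?L *\<^sub>v s \<le> vec_rows (qpw S) I + mat_rows (qpS S) I *\<^sub>v x"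
    unfolding split[OF L]
    by (rule vec_le_uminus_minus[OF mult_mat_vec_carrier[OF L wA] mult_mat_vec_carrier[OF LS xc] wI SIx
          ineqs(2)[unfolded minus_mult_distrib_mat_vec[OF LS SI xc]]])
  then have primal: "?L *\<^sub>v s \<le> ?b + (?GI * ?Hi) *\<^sub>v ?g" unfolding shifted[OF Iq] .
  have s_eq: "s = ?a + (?GA * ?Hi) *\<^sub>v ?g" unfolding s_def shifted[OF Aq] ..
  define \<mu> where "\<mu> = - (?W *\<^sub>v s)"
  define U where "U = - (?Hi *\<^sub>v (?g + ?GA\<^sup>T *\<^sub>v \<mu>))"
  note point = parametric_kkt_point[OF qpH_carrier Hi(1,2) GA GI W(1,2) g vec_rows_carrier[OF Aq rhs]
      vec_rows_carrier[OF Iq rhs], folded s_eq, OF dual primal, folded \<mu>_def, folded U_def]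
  have GU: "qpG S *\<^sub>v U \<in> carrier_vec q" using G point(1) by (rule mult_mat_vec_carrier)
  have active: "\<forall>i\<in>\<A>. (qpG S *\<^sub>v U) $ i = (qpw S + qpE S *\<^sub>v x) $ i"
    using point(5) unfolding mat_rows_mult_vec[OF Aq G] vec_rows_eq_iff[OF Aq GU rhs] .
  moreover have "\<forall>i\<in>I. (qpG S *\<^sub>v U) $ i \<le> (qpw S + qpE S *\<^sub>v x) $ i"
    using point(6) unfolding mat_rows_mult_vec[OF Iq G] vec_rows_le_iff[OF Iq GU rhs] .
  ultimately have "(qpG S *\<^sub>v U) $ i \<le> (qpw S + qpE S *\<^sub>v x) $ i" if "i < q" for i
    using that by (cases "i \<in> \<A>") (simp_all add: I_def constraints_def q_def del: index_mult_mat_vec)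
  then have "qpG S *\<^sub>v U \<le> qpw S + qpE S *\<^sub>v x"
    unfolding less_eq_vec_def carrier_vecD[OF GU] carrier_vecD[OF rhs] by blast
  then have "qp_feasible S x U" using point(1) by (simp add: qp_feasible_def)
  note opt = qp_kkt_optimal[OF xc A this point(2) point(4) point(3) active[rule_format]]
  show "x \<in> feasible_states S" using xc opt(1) by (auto simp: feasible_states_def)
  show "qp_opt S x \<in> carrier_vec (m * N)" using point(1) opt(2) by simp
  show "\<forall>i\<in>\<A>. (qpG S *\<^sub>v qp_opt S x) $ i = (qpw S + qpE S *\<^sub>v x) $ i" using active opt(2) by simp
qed

end

section \<open>The feedback law\<close>

theorem corollary2:
  fixes S :: mpc and \<A> :: "nat set"
  assumes "mpc_assumptions S"
    and "\<A> \<subseteq> constraints S"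
    and "\<exists>x \<in> feasible_states S. active_set S x = \<A>"
    and "full_row_rank (mat_rows (qpG S) \<A>)"
    and "invertible_mat (mat_rows (G11 S) (\<A> \<inter> stage0_constraints S))"
  shows "\<forall>\<A>' \<in> extension_sets S \<A>. card (\<A>' \<inter> stage0_constraints S) = dim_u S \<longrightarrow>
    (let \<A>0 = \<A>' \<inter> stage0_constraints S;
         K = inv_mat (mat_rows (G11 S) \<A>0) * mat_rows (qpE S) \<A>0;
         b = inv_mat (mat_rows (G11 S) \<A>0) *\<^sub>v vec_rows (qpw S) \<A>0
     in \<forall>x \<in> critical_polytope S \<A>'.
          x \<in> feasible_states S \<and> vec_first (qp_opt S x) (dim_u S) = K *\<^sub>v x + b)"
proof (intro ballI impI)
  interpret mpc_assumptions S by (rule assms(1))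
  fix \<A>' assume ext: "\<A>' \<in> extension_sets S \<A>" and card: "card (\<A>' \<inter> stage0_constraints S) = m"
  have A': "\<A>' \<subseteq> constraints S" and sub: "\<A>' \<subseteq> \<A>"
    using ext by (auto simp: extension_sets_def)
  have Aq: "\<A> \<subseteq> {..<dim_row (qpG S)}" using assms(2) by (simp add: constraints_def)
  define \<A>0 where "\<A>0 = \<A>' \<inter> stage0_constraints S"
  \<comment> \<open>The stage 0 constraints of \<open>\<A>\<close> are kept, so the assumed invertibility applies to \<open>\<A>0\<close>.\<close>
  have A0_eq: "\<A>0 = \<A> \<inter> stage0_constraints S"
    using ext by (auto simp: extension_sets_def \<A>0_def)
  have A0_stage: "\<A>0 \<subseteq> {..<dim_row (matU S) + dim_row (matX S)}"
    by (auto simp: \<A>0_def stage0_constraints_def)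
  have A0_q: "\<A>0 \<subseteq> {..<dim_row (qpG S)}"
    using A' by (auto simp: \<A>0_def constraints_def)
  have card0: "card \<A>0 = m" using card by (simp add: \<A>0_def)
  have M: "mat_rows (G11 S) \<A>0 \<in> carrier_mat m m"
    using mat_rows_carrier[OF A0_stage G11_carrier] card0 by simp
  have ker: "y = 0\<^sub>v (card \<A>')"
    if "y \<in> carrier_vec (card \<A>')" "(mat_rows (qpG S) \<A>')\<^sup>T *\<^sub>v y = 0\<^sub>v (m * N)" for y
    using left_kernel_mat_rows_subset[OF qpG_carrier Aq sub _ that]
      full_row_rank_left_kernel[OF mat_rows_carrier[OF Aq qpG_carrier] assms(4)] by blast
  have "x \<in> feasible_states S \<and> vec_first (qp_opt S x) m =
      (inv_mat (mat_rows (G11 S) \<A>0) * mat_rows (qpE S) \<A>0) *\<^sub>v x +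
      inv_mat (mat_rows (G11 S) \<A>0) *\<^sub>v vec_rows (qpw S) \<A>0"
    if x: "x \<in> critical_polytope S \<A>'" for x
  proof
    note opt = critical_polytope_optimal[OF A' ker x]
    show "x \<in> feasible_states S" by (rule opt(1))
    then have xc: "x \<in> carrier_vec n" by (simp add: feasible_states_def)
    have Ex: "qpE S *\<^sub>v x \<in> carrier_vec (dim_row (qpG S))" using qpE_carrier xc by (rule mult_mat_vec_carrier)
    let ?u = "vec_first (qp_opt S x) m"
    have "mat_rows (G11 S) \<A>0 *\<^sub>v ?u = vec_rows (G11 S *\<^sub>v ?u) \<A>0"
      by (rule mat_rows_mult_vec[OF A0_stage G11_carrier])
    also have "\<dots> = vec_rows (qpw S + qpE S *\<^sub>v x) \<A>0"
    proof (rule eq_vecI)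
      note G11u = mult_mat_vec_carrier[OF G11_carrier vec_first_carrier[of "qp_opt S x"]]
      note rhs = qp_rhs_carrier[OF xc]
      fix i assume "i < dim_vec (vec_rows (qpw S + qpE S *\<^sub>v x) \<A>0)"
      then have i: "i < card \<A>0" using carrier_vecD[OF vec_rows_carrier[OF A0_q rhs]] by simp
      have a: "pick \<A>0 i \<in> \<A>0" using i by (rule pick_in_set_le)
      then have "(G11 S *\<^sub>v ?u) $ pick \<A>0 i = (qpw S + qpE S *\<^sub>v x) $ pick \<A>0 i"
        using stage0_rows_mult[OF _ opt(2)] opt(3) unfolding \<A>0_def by auto
      then show "vec_rows (G11 S *\<^sub>v ?u) \<A>0 $ i = vec_rows (qpw S + qpE S *\<^sub>v x) \<A>0 $ i"
        unfolding vec_rows_index[OF A0_stage G11u i] vec_rows_index[OF A0_q rhs i] .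
    next
      show "dim_vec (vec_rows (G11 S *\<^sub>v ?u) \<A>0) = dim_vec (vec_rows (qpw S + qpE S *\<^sub>v x) \<A>0)"
        using carrier_vecD[OF vec_rows_carrier[OF A0_q qp_rhs_carrier[OF xc]]]
          carrier_vecD[OF vec_rows_carrier[OF A0_stage mult_mat_vec_carrier[OF G11_carrier vec_first_carrier]]] by simp
    qed
    also have "\<dots> = vec_rows (qpw S) \<A>0 + mat_rows (qpE S) \<A>0 *\<^sub>v x"
      unfolding vec_rows_add[OF A0_q qpw_carrier Ex] mat_rows_mult_vec[OF A0_q qpE_carrier] ..
    finally have eq: "mat_rows (G11 S) \<A>0 *\<^sub>v ?u = vec_rows (qpw S) \<A>0 + mat_rows (qpE S) \<A>0 *\<^sub>v x" .
    show "?u = (inv_mat (mat_rows (G11 S) \<A>0) * mat_rows (qpE S) \<A>0) *\<^sub>v x +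
        inv_mat (mat_rows (G11 S) \<A>0) *\<^sub>v vec_rows (qpw S) \<A>0"
      using inv_mat_solves_shifted[OF assms(5)[folded A0_eq] M vec_first_carrier
          mat_rows_carrier[OF A0_q qpE_carrier, unfolded card0] xc
          vec_rows_carrier[OF A0_q qpw_carrier, unfolded card0] eq] .
  qed
  then show "let \<A>0 = \<A>' \<inter> stage0_constraints S;
         K = inv_mat (mat_rows (G11 S) \<A>0) * mat_rows (qpE S) \<A>0;
         b = inv_mat (mat_rows (G11 S) \<A>0) *\<^sub>v vec_rows (qpw S) \<A>0
     in \<forall>x \<in> critical_polytope S \<A>'.
          x \<in> feasible_states S \<and> vec_first (qp_opt S x) m = K *\<^sub>v x + b"
    unfolding Let_def \<A>0_def by blast
qed

end
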